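(* For $L=\rho_c$ and $v=\mathbf 1\in L$, $w=\mathbf 1^*\in L^*$ the dual of $\mathbf 1$, the correlation function satisfies $$m_{\mathbf 1^*,\mathbf 1}(z_1,\ldots,z_n)=(-q_3)^{-n(n-1)/2}c^n\prod_{i<j}\frac{(z_i-q_3z_j)(z_j-q_3z_i)}{(z_i-z_j)^2}.$$
   Context: $q_1,q_2,q_3\in\mathbb C^*$, $q_1q_2q_3=1$, $q_i^m\ne1$ for all $m\in\mathbb N$, and $c\in\mathbb C^*$. $\mathfrak h$ is the Heisenberg algebra generated by $a_n$ ($n\in\mathbb Z\setminus\{0\}$) with $[a_m,a_n]=m\frac{1-q_1^{|m|}}{1-q_2^{-|m|}}\delta_{m,-n}$, and $\mathcal F=\mathrm{Ind}_{\mathfrak h^+}^{\mathfrak h}\mathbb C\mathbf 1$ is its Fock representation, where $\mathfrak h^+$ is generated by the $a_n$, $n>0$, which annihilate $\mathbf 1$. $\rho_c$ is the representation on $\mathcal F$ (of an algebra with a generating current $\tilde e(z)=\sum_{i\in\mathbb Z}\tilde e_iz^{-i}$) in which $$\rho_c(\tilde e(z))=c\exp\Big(\sum_{n>0}\frac{1-q_2^n}na_{-n}z^n\Big)\exp\Big(-\sum_{n>0}\frac{1-q_2^{-n}}na_nz^{-n}\Big).$$ For $v\in L$, $w\in L^*$, the correlation function is $$m_{w,v}(z_1,\ldots,z_n):=\langle w|\tilde e(z_1)\cdots\tilde e(z_n)|v\rangle\cdot\prod_{i<j}\omega^m(z_i,z_j),\qquad\omega^m(x,y)=\frac{(x-q_1y)(x-q_2y)(x-q_3y)}{(x-y)^3}.$$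 The matrix coefficient is a power series convergent in the region $|z_1|\gg|z_2|\gg\cdots\gg|z_n|$ and the equality is one of rational functions. $\mathbf 1^*$ is the functional with $\mathbf 1^*(\mathbf 1)=1$ vanishing on $a_{-n}\mathcal F$, $n>0$. *)

theory Defs
  imports
    "HOL-Analysis.Analysis"
    "HOL-Library.Poly_Mapping"
    "HOL-Computational_Algebra.Formal_Power_Series"
    "HOL-Computational_Algebra.Fraction_Field"
begin

section \<open>The free algebra on the modes\<close>

typedef mode = "{n::int. n \<noteq> 0}"
  by (rule exI[of _ 1]) simp

text \<open>The free monoid, written additively, so that the convolution product of
  \<^theory>\<open>HOL-Library.Poly_Mapping\<close> on words is the product of the free associative algebra.\<close>

datatype 'g fword = FWord (letters: "'g list")

instantiation fword :: (type) monoid_add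
begin

definition zero_fword :: "'a fword" where
  "0 = FWord []"

definition plus_fword :: "'a fword \<Rightarrow> 'a fword \<Rightarrow> 'a fword" where
  "u + v = FWord (letters u @ letters v)"

instance
  by standard (simp_all add: zero_fword_def plus_fword_def)

end

type_synonym free_alg = "mode fword \<Rightarrow>\<^sub>0 complex"

text \<open>Scalars, as elements of any complex monoid algebra (used for the free algebra and for
  polynomial rings).\<close>

definition cst :: "complex \<Rightarrow> ('m::monoid_add \<Rightarrow>\<^sub>0 complex)" where
  "cst k = Poly_Mapping.single 0 k"

text \<open>The generator \<open>a\<^sub>n\<close>; meaningful only for \<open>n \<noteq> 0\<close>.\<close>

definition mode_gen :: "int \<Rightarrow> free_alg" where
  "mode_gen n = Poly_Mapping.single (FWord [Abs_mode n]) 1"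

section \<open>The Heisenberg algebra and its Fock representation\<close>

definition heis_bracket :: "complex \<Rightarrow> complex \<Rightarrow> int \<Rightarrow> int \<Rightarrow> complex" where
  "heis_bracket q1 q2 m n =
    (if m = - n then of_int m * (1 - q1 powi \<bar>m\<bar>) / (1 - q2 powi (- \<bar>m\<bar>)) else 0)"

text \<open>Write the Heisenberg algebra as the free algebra modulo the two-sided ideal generated by
  the commutation relations.  The one-dimensional module of its positive part is the quotient of
  that part by the left ideal generated by the \<open>a\<^sub>n\<close>, \<open>n > 0\<close>.  Tensoring up, the induced module is
  the Heisenberg algebra modulo the left ideal generated by the same elements, that is, the free
  algebra modulo the following subspace.  (Closed under scalars because \<open>x\<close> is
  arbitrary.)\<close>

inductive_set fock_null :: "complex \<Rightarrow> complex \<Rightarrow> free_alg set" for q1 q2 where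
  zero: "0 \<in> fock_null q1 q2"
| add: "x \<in> fock_null q1 q2 \<Longrightarrow> y \<in> fock_null q1 q2 \<Longrightarrow> x + y \<in> fock_null q1 q2"
| comm: "m \<noteq> 0 \<Longrightarrow> n \<noteq> 0 \<Longrightarrow>
    x * (mode_gen m * mode_gen n - mode_gen n * mode_gen m - cst (heis_bracket q1 q2 m n)) * y
      \<in> fock_null q1 q2"
| annihil: "n > 0 \<Longrightarrow> x * mode_gen n \<in> fock_null q1 q2"

type_synonym fock_vec = "free_alg set"

definition fock_class :: "complex \<Rightarrow> complex \<Rightarrow> free_alg \<Rightarrow> fock_vec" where
  "fock_class q1 q2 x = {y. y - x \<in> fock_null q1 q2}"

definition fock :: "complex \<Rightarrow> complex \<Rightarrow> fock_vec set" where
  "fock q1 q2 = range (fock_class q1 q2)"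

definition vac :: "complex \<Rightarrow> complex \<Rightarrow> fock_vec" where
  "vac q1 q2 = fock_class q1 q2 1"

definition heis_act :: "complex \<Rightarrow> complex \<Rightarrow> free_alg \<Rightarrow> fock_vec \<Rightarrow> fock_vec" where
  "heis_act q1 q2 x X = (\<Union>y\<in>X. fock_class q1 q2 (x * y))"

text \<open>The (full algebraic) dual space; functionals are normalised outside the Fock space so that
  they are determined by their values on it.\<close>

definition fock_dual :: "complex \<Rightarrow> complex \<Rightarrow> (fock_vec \<Rightarrow> complex) set" where
  "fock_dual q1 q2 = {w \<in> extensional (fock q1 q2).
    (\<forall>x y. w (fock_class q1 q2 (x + y)) = w (fock_class q1 q2 x) + w (fock_class q1 q2 y)) \<and>
    (\<forall>k x. w (fock_class q1 q2 (cst k * x)) = k * w (fock_class q1 q2 x))}"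

definition vac_dual :: "complex \<Rightarrow> complex \<Rightarrow> fock_vec \<Rightarrow> complex" where
  "vac_dual q1 q2 = (THE w. w \<in> fock_dual q1 q2 \<and> w (vac q1 q2) = 1 \<and>
    (\<forall>n>0. \<forall>X\<in>fock q1 q2. w (heis_act q1 q2 (mode_gen (- n)) X) = 0))"

section \<open>The vertex operator\<close>

text \<open>The exponential of a series with zero constant term, over the noncommutative free
  algebra.\<close>

definition exp_series :: "free_alg fps \<Rightarrow> free_alg fps" where
  "exp_series B = fps_compose (Abs_fps (\<lambda>k. cst (1 / fact k))) B"

text \<open>A series in \<open>z\<close>.\<close>

definition vertex_creation :: "complex \<Rightarrow> free_alg fps" where
  "vertex_creation q2 = exp_series (Abs_fps (\<lambda>n. if n = 0 then 0
     else cst ((1 - q2 ^ n) / of_nat n) * mode_gen (- int n)))"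

text \<open>A series in \<open>z\<^sup>-\<^sup>1\<close>.\<close>

definition vertex_annihilation :: "complex \<Rightarrow> free_alg fps" where
  "vertex_annihilation q2 = exp_series (- Abs_fps (\<lambda>n. if n = 0 then 0
     else cst ((1 - q2 powi (- int n)) / of_nat n) * mode_gen (int n)))"

text \<open>The coefficient of \<open>z\<^sup>-\<^sup>i\<close> in the vertex operator, applied to a vector: the product of the
  coefficient of \<open>z\<^sup>l\<^sup>-\<^sup>i\<close> of the creation part and that of \<open>z\<^sup>-\<^sup>l\<close> of the annihilation part, summed
  over all \<open>l\<close>.  On each vector all but finitely many coefficients of the annihilation part act by
  zero; these are left out of the sum.\<close>

definition rho_e :: "complex \<Rightarrow> complex \<Rightarrow> complex \<Rightarrow> int \<Rightarrow> fock_vec \<Rightarrow> fock_vec" where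
  "rho_e q1 q2 c i X = (\<Union>x\<in>X. fock_class q1 q2 (cst c *
     (\<Sum>l | int l \<ge> i \<and> fps_nth (vertex_annihilation q2) l * x \<notin> fock_null q1 q2.
        fps_nth (vertex_creation q2) (nat (int l - i)) * fps_nth (vertex_annihilation q2) l * x)))"

section \<open>Rational functions\<close>

text \<open>Polynomials and rational functions in variables indexed by \<open>nat\<close>; the variables
  \<open>z\<^sub>1, \<dots>, z\<^sub>n\<close> are those with index \<open>0, \<dots>, n - 1\<close>.\<close>

type_synonym mpoly = "(nat \<Rightarrow>\<^sub>0 nat) \<Rightarrow>\<^sub>0 complex"
type_synonym ratfun = "mpoly fract"

definition mpoly_eval :: "(nat \<Rightarrow> complex) \<Rightarrow> mpoly \<Rightarrow> complex" where
  "mpoly_eval z p = (\<Sum>m\<in>Poly_Mapping.keys p. Poly_Mapping.lookup p m *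
     (\<Prod>j\<in>Poly_Mapping.keys m. z j ^ Poly_Mapping.lookup m j))"

definition Var :: "nat \<Rightarrow> ratfun" where
  "Var j = Fract (Poly_Mapping.single (Poly_Mapping.single j 1) 1) 1"

definition Cst :: "complex \<Rightarrow> ratfun" where
  "Cst k = Fract (cst k) 1"

section \<open>Correlation functions\<close>

text \<open>The region \<open>|z\<^sub>1| \<gg> \<dots> \<gg> |z\<^sub>n|\<close> with ratio \<open>R\<close>; the variables not involved are left free.\<close>

definition region :: "real \<Rightarrow> nat \<Rightarrow> (nat \<Rightarrow> complex) set" where
  "region R n = {z. (\<forall>i<n. z i \<noteq> 0) \<and> (\<forall>i. Suc i < n \<longrightarrow> norm (z i) > R * norm (z (Suc i)))}"

text \<open>The Laurent series with coefficient \<open>f [k\<^sub>1, \<dots>, k\<^sub>n]\<close> at the product of the powers of \<open>z\<^sub>j\<close> with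
  exponents \<open>- k\<^sub>j\<close> converges in some such region, and its sum there is the rational function
  \<open>r = P / Q\<close>.  This determines \<open>r\<close>, since a polynomial vanishing on such a region is zero.\<close>

definition has_expansion :: "nat \<Rightarrow> (int list \<Rightarrow> complex) \<Rightarrow> ratfun \<Rightarrow> bool" where
  "has_expansion n f r \<longleftrightarrow> (\<exists>P Q. Q \<noteq> 0 \<and> r = Fract P Q \<and>
     (\<exists>R>0. \<forall>z\<in>region R n. \<exists>S.
        ((\<lambda>ks. f ks * (\<Prod>j<n. z j powi (- (ks ! j)))) has_sum S) {ks. length ks = n} \<and>
        mpoly_eval z Q * S = mpoly_eval z P))"

text \<open>For a current with modes \<open>E i\<close> (the coefficient of \<open>z\<^sup>-\<^sup>i\<close>), a functional \<open>w\<close> and a vector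
  \<open>v\<close>.\<close>

definition matrix_coeff ::
  "nat \<Rightarrow> (int \<Rightarrow> 'v \<Rightarrow> 'v) \<Rightarrow> ('v \<Rightarrow> complex) \<Rightarrow> 'v \<Rightarrow> ratfun" where
  "matrix_coeff n E w v = (THE r. has_expansion n (\<lambda>ks. w (foldr E ks v)) r)"

definition omega_m :: "complex \<Rightarrow> complex \<Rightarrow> complex \<Rightarrow> ratfun \<Rightarrow> ratfun \<Rightarrow> ratfun" where
  "omega_m q1 q2 q3 x y =
     (x - Cst q1 * y) * (x - Cst q2 * y) * (x - Cst q3 * y) / (x - y) ^ 3"

definition corr_fun ::
  "complex \<Rightarrow> complex \<Rightarrow> complex \<Rightarrow> nat \<Rightarrow> (int \<Rightarrow> 'v \<Rightarrow> 'v) \<Rightarrow> ('v \<Rightarrow> complex) \<Rightarrow> 'v \<Rightarrow> ratfun" where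
  "corr_fun q1 q2 q3 n E w v =
     matrix_coeff n E w v * (\<Prod>j<n. \<Prod>i<j. omega_m q1 q2 q3 (Var i) (Var j))"

end

theory Submission
  imports Defs
begin

text \<open>
  Write the vertex operator as \<open>c C(z) A(z)\<close>, where \<open>C\<close> is the exponential in the creation
  operators \<open>a\<^sub>-\<^sub>n\<close> and \<open>A\<close> the one in the annihilation operators \<open>a\<^sub>n\<close>.  The commutators
  \<open>[a\<^sub>m, a\<^sub>n]\<close> are scalars, so moving \<open>A(x)\<close> to the right past \<open>C(y)\<close> costs a scalar factor
  only: \<open>A(x) C(y) = g(y/x) C(y) A(x)\<close> with
  \<open>g(t) = exp (- \<Sum>\<^sub>n (1 - q1\<^sup>n) (1 - q2\<^sup>n) t\<^sup>n / n) =
  (1 - t) (1 - q1 q2 t) / ((1 - q1 t) (1 - q2 t))\<close>.  In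
  \<open>\<langle>1\<^sup>*| e(z\<^sub>1) \<cdots> e(z\<^sub>n) |1\<rangle>\<close> each \<open>A\<close> can be moved onto the vacuum and each \<open>C\<close> onto its dual,
  where they act as \<open>1\<close>.  What remains is \<open>c\<^sup>n\<close> times the product of the \<open>g(z\<^sub>j/z\<^sub>i)\<close>, \<open>i < j\<close>.
  Multiplying \<open>g(y/x)\<close> by \<open>\<omega>(x, y)\<close> cancels the poles at \<open>x = q1 y\<close> and \<open>x = q2 y\<close>; because
  \<open>q1 q2 = 1/q3\<close>, the result is \<open>(- q3)\<^sup>-\<^sup>1 (x - q3 y) (y - q3 x) / (x - y)\<^sup>2\<close>, and there are
  \<open>n (n - 1) / 2\<close> pairs.

  To make sense of products of operators, the free algebra is represented by linear endomorphisms of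
  a space of polynomials and power series in infinitely many variables, on which \<open>a\<^sub>-\<^sub>n\<close> is a
  multiplication and \<open>a\<^sub>n\<close> a multiple of a partial derivative.  The Heisenberg relations become equations in a
  ring, and the constant term is the functional dual to the vacuum.  That the defining
  properties of the dual vacuum leave no other choice follows from normal ordering: modulo the null
  space, every word is a combination of words in creation operators with the same sum of mode
  numbers (\<open>normal_orderable_word\<close>).  The same fact shows that words with a positive sum are null
  (\<open>positive_total_mode_null\<close>), whence all but finitely many coefficients of \<open>A\<close> kill a given vector.

  The exchange relation is proved coefficientwise in \<open>wick_coeff\<close>: both sides solve the same
  linear differential equation.  Applied to the leftmost operator, it gives a recursion on the
  number of operators (\<open>correlator_Cons\<close>), which turns the convergence of the full Laurent series and
  its value into an induction with absolutely convergent sums (\<open>has_sum_correlator\<close>).  Finally a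
  rational function is determined by its expansion, since a polynomial that vanishes on a region
  \<open>|z\<^sub>1| \<gg> \<cdots> \<gg> |z\<^sub>n|\<close> is zero (\<open>mpoly_zero_if_zero_on_region\<close>).
\<close>

section \<open>Homomorphisms out of monoid algebras\<close>

text \<open>Both the representation of the free algebra on the Fock space and the evaluation of polynomials
  arise by extending a multiplicative map on a monoid linearly to its monoid algebra; the map \<open>\<iota>\<close>
  embeds the coefficients in the target ring.\<close>

definition monoid_alg_ext :: "('a \<Rightarrow> 'r::ring_1) \<Rightarrow> ('m \<Rightarrow> 'r) \<Rightarrow> ('m \<Rightarrow>\<^sub>0 'a::zero) \<Rightarrow> 'r" where
  "monoid_alg_ext \<iota> h x = (\<Sum>u\<in>Poly_Mapping.keys x. \<iota> (Poly_Mapping.lookup x u) * h u)"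

lemma poly_mapping_eq_sum_single:
  "x = (\<Sum>u\<in>Poly_Mapping.keys x. Poly_Mapping.single u (Poly_Mapping.lookup x u))"
  by (rule poly_mapping_eqI)
     (auto simp: lookup_sum lookup_single when_def in_keys_iff sum.delta' cong: if_cong)

lemma poly_mapping_additive_induct [case_names zero single add]:
  fixes x :: "'m \<Rightarrow>\<^sub>0 'a::comm_monoid_add"
  assumes "P 0" "\<And>u k. P (Poly_Mapping.single u k)" "\<And>x y. P x \<Longrightarrow> P y \<Longrightarrow> P (x + y)"
  shows "P x"
proof -
  have "P (\<Sum>u\<in>A. Poly_Mapping.single u (Poly_Mapping.lookup x u))" if "finite A" for A
    using that by induction (use assms in auto)
  thus ?thesis by (subst poly_mapping_eq_sum_single) simp
qed

lemma monoid_alg_ext_superset: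
  assumes "\<iota> 0 = 0" "finite A" "Poly_Mapping.keys x \<subseteq> A"
  shows "monoid_alg_ext \<iota> h x = (\<Sum>u\<in>A. \<iota> (Poly_Mapping.lookup x u) * h u)"
  unfolding monoid_alg_ext_def
  by (rule sum.mono_neutral_left) (use assms in \<open>auto simp: in_keys_iff\<close>)

lemma monoid_alg_ext_zero [simp]: "monoid_alg_ext \<iota> h 0 = 0"
  by (simp add: monoid_alg_ext_def)

lemma monoid_alg_ext_single:
  assumes "\<iota> 0 = 0"
  shows "monoid_alg_ext \<iota> h (Poly_Mapping.single u k) = \<iota> k * h u"
  using assms by (simp add: monoid_alg_ext_def)

lemma monoid_alg_ext_add:
  fixes x y :: "'m \<Rightarrow>\<^sub>0 'a::comm_monoid_add"
  assumes "\<iota> 0 = 0" "\<And>a b. \<iota> (a + b) = \<iota> a + \<iota> b"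
  shows "monoid_alg_ext \<iota> h (x + y) = monoid_alg_ext \<iota> h x + monoid_alg_ext \<iota> h y"
proof -
  let ?A = "Poly_Mapping.keys x \<union> Poly_Mapping.keys y"
  have "monoid_alg_ext \<iota> h z = (\<Sum>u\<in>?A. \<iota> (Poly_Mapping.lookup z u) * h u)"
    if "Poly_Mapping.keys z \<subseteq> ?A" for z
    using that assms by (intro monoid_alg_ext_superset) auto
  thus ?thesis using assms keys_add[of x y]
    by (simp add: lookup_add distrib_right sum.distrib)
qed

lemma monoid_alg_ext_mult:
  fixes x y :: "'m::monoid_add \<Rightarrow>\<^sub>0 'a::semiring_1"
  assumes "\<iota> 0 = 0" "\<And>a b. \<iota> (a + b) = \<iota> a + \<iota> b" "\<And>a b. \<iota> (a * b) = \<iota> a * \<iota> b"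
    and "\<And>u v. h (u + v) = h u * h v" "\<And>a u. h u * \<iota> a = \<iota> a * h u"
  shows "monoid_alg_ext \<iota> h (x * y) = monoid_alg_ext \<iota> h x * monoid_alg_ext \<iota> h y"
proof -
  note ext = monoid_alg_ext_add[OF assms(1,2)] monoid_alg_ext_single[of \<iota>, OF assms(1)]
  have "monoid_alg_ext \<iota> h (Poly_Mapping.single u k * y) =
        monoid_alg_ext \<iota> h (Poly_Mapping.single u k) * monoid_alg_ext \<iota> h y" for u k
  proof (induction y rule: poly_mapping_additive_induct)
    case (single v l)
    show ?case by (simp add: mult_single ext assms(3,4) mult.assoc) (metis assms(5) mult.assoc)
  qed (simp_all add: distrib_left ext)
  thus ?thesis
    by (induction x rule: poly_mapping_additive_induct) (simp_all add: distrib_right ext)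
qed

section \<open>The Heisenberg algebra acting on polynomials\<close>

text \<open>A polynomial in the variables \<open>p\<^sub>1, p\<^sub>2, \<dots>\<close> is given by its coefficients, indexed by exponent
  vectors.  Arbitrary coefficient functions are allowed, which includes formal power series: this
  keeps the operators below total functions without finiteness conditions, and the states
  generated from the vacuum are polynomials all the same.\<close>

type_synonym state = "(nat \<Rightarrow> nat) \<Rightarrow> complex"

text \<open>Linearity over the complex numbers is part of the type so that scalars are central.\<close>

typedef endo =
  "{f :: state \<Rightarrow> state. \<forall>k s t. f (\<lambda>e. k * s e + t e) = (\<lambda>e. k * f s e + f t e)}"
  morphisms app Endo
  by (rule exI[of _ id]) simp

setup_lifting type_definition_endo

instantiation endo :: ring_1
begin
lift_definition zero_endo :: endo is "\<lambda>s e. 0" by simp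
lift_definition one_endo :: endo is "\<lambda>s. s" by simp
lift_definition plus_endo :: "endo \<Rightarrow> endo \<Rightarrow> endo" is "\<lambda>f g s e. f s e + g s e"
  by (simp add: algebra_simps fun_eq_iff)
lift_definition minus_endo :: "endo \<Rightarrow> endo \<Rightarrow> endo" is "\<lambda>f g s e. f s e - g s e"
  by (simp add: algebra_simps fun_eq_iff)
lift_definition uminus_endo :: "endo \<Rightarrow> endo" is "\<lambda>f s e. - f s e"
  by (simp add: algebra_simps fun_eq_iff)
lift_definition times_endo :: "endo \<Rightarrow> endo \<Rightarrow> endo" is "\<lambda>f g s. f (g s)"
  by simp
instance
proof
  fix a b c :: endo
  show "a * (b + c) = a * b + a * c"
  proof (transfer, rule ext)
    fix a b c :: "state \<Rightarrow> state" and s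
    assume "\<forall>k s t. a (\<lambda>e. k * s e + t e) = (\<lambda>e. k * a s e + a t e)"
    from this[rule_format, of 1 "b s" "c s"]
    show "a (\<lambda>e. b s e + c s e) = (\<lambda>e. a (b s) e + a (c s) e)" by simp
  qed
  show "0 \<noteq> (1::endo)"
  proof (transfer, rule notI)
    assume "(\<lambda>s e. 0) = (\<lambda>s::state. s)"
    from fun_cong[OF fun_cong[OF this, of "\<lambda>_. 1"]] show False by simp
  qed
qed (transfer; simp add: fun_eq_iff algebra_simps)+
end

lift_definition scalar_endo :: "complex \<Rightarrow> endo" is "\<lambda>k s e. k * s e"
  by (simp add: algebra_simps)

lemma app_lin: "app f (\<lambda>e. k * s e + t e) = (\<lambda>e. k * app f s e + app f t e)"
  by transfer simp

lemma app_zero [simp]: "app f (\<lambda>e. 0) = (\<lambda>e. 0)"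
  using app_lin[of f "-1" "\<lambda>e. 0" "\<lambda>e. 0"] by (simp add: fun_eq_iff)

lemma app_scale: "app f (\<lambda>e. k * s e) = (\<lambda>e. k * app f s e)"
  using app_lin[of f k s "\<lambda>e. 0"] by simp

lemma app_sum: "app f (\<lambda>e. \<Sum>i\<in>I. k i * s i e) = (\<lambda>e. \<Sum>i\<in>I. k i * app f (s i) e)"
proof (induction I rule: infinite_finite_induct)
  case (insert i I)
  thus ?case by (simp add: app_lin)
qed simp_all

lemma app_simps [simp]:
  "app (f * g) s = app f (app g s)" "app (f + g) s = (\<lambda>e. app f s e + app g s e)"
  "app (f - g) s = (\<lambda>e. app f s e - app g s e)"
  "app 0 s = (\<lambda>e. 0)" "app 1 s = s" "app (scalar_endo k) s = (\<lambda>e. k * s e)"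
  by (transfer; simp)+

lemma app_sum_left: "app (\<Sum>i\<in>I. f i) s e = (\<Sum>i\<in>I. app (f i) s e)"
  by (induction I rule: infinite_finite_induct) simp_all

lemma endo_eqI: "(\<And>s e. app f s e = app g s e) \<Longrightarrow> f = g"
  by transfer (simp add: fun_eq_iff)

lemma scalar_endo_hom [simp]:
  "scalar_endo 0 = 0" "scalar_endo 1 = 1" 
  by (rule endo_eqI; simp add: algebra_simps)+
lemma scalar_endo_arith:
  "scalar_endo (a + b) = scalar_endo a + scalar_endo b"
  "scalar_endo (a * b) = scalar_endo a * scalar_endo b"
  by (rule endo_eqI; simp add: algebra_simps)+

lemma scalar_endo_commute: "f * scalar_endo k = scalar_endo k * f"
  by (rule endo_eqI) (simp add: app_scale)

lemma scalar_endo_of_nat: "scalar_endo (of_nat n) = of_nat n"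
  by (induction n) (simp_all add: scalar_endo_arith)

text \<open>Multiplication by \<open>p\<^sub>-\<^sub>n\<close> for \<open>n < 0\<close>, and \<open>[a\<^sub>n, a\<^sub>-\<^sub>n] \<partial>/\<partial>p\<^sub>n\<close> for \<open>n > 0\<close>.\<close>

lift_definition heis_op :: "complex \<Rightarrow> complex \<Rightarrow> int \<Rightarrow> endo" is
  "\<lambda>q1 q2 n s e. if n < 0 then (if e (nat (- n)) = 0 then 0 else s (e(nat (- n) := e (nat (- n)) - 1)))
     else heis_bracket q1 q2 n (- n) * of_nat (Suc (e (nat n))) * s (e(nat n := Suc (e (nat n))))"
  by (auto simp: fun_eq_iff algebra_simps)

lemma app_heis_op: "app (heis_op q1 q2 n) s e =
  (if n < 0 then (if e (nat (- n)) = 0 then 0 else s (e(nat (- n) := e (nat (- n)) - 1)))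
     else heis_bracket q1 q2 n (- n) * of_nat (Suc (e (nat n))) * s (e(nat n := Suc (e (nat n)))))"
  by transfer simp

lemma heis_bracket_antisym: "heis_bracket q1 q2 m n = - heis_bracket q1 q2 n m"
  by (auto simp: heis_bracket_def)

text \<open>Operators in different variables commute, as do equal ones; the remaining case is the
  canonical commutation relation of \<open>p\<close> and \<open>\<partial>/\<partial>p\<close>.\<close>

lemma heis_op_commutator:
  assumes "m \<noteq> 0" "n \<noteq> 0"
  shows "heis_op q1 q2 m * heis_op q1 q2 n - heis_op q1 q2 n * heis_op q1 q2 m =
         scalar_endo (heis_bracket q1 q2 m n)"
proof (rule endo_eqI)
  fix s e
  consider "m = n" | "m = - n" | "\<bar>m\<bar> \<noteq> \<bar>n\<bar>" by linarith
  thus "app (heis_op q1 q2 m * heis_op q1 q2 n - heis_op q1 q2 n * heis_op q1 q2 m) s e =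
      app (scalar_endo (heis_bracket q1 q2 m n)) s e"
  proof cases
    case 1
    thus ?thesis using assms by (simp add: heis_bracket_def)
  next
    case 2
    have "heis_bracket q1 q2 (-n) n = - heis_bracket q1 q2 n (-n)"
      by (rule heis_bracket_antisym)
    thus ?thesis using assms 2 by (cases "n > 0") (simp_all add: app_heis_op algebra_simps)
  next
    case 3
    define i where "i = nat \<bar>m\<bar>"
    define j where "j = nat \<bar>n\<bar>"
    have ij: "i \<noteq> j" using 3 by (simp add: i_def j_def)
    have "heis_bracket q1 q2 m n = 0" using 3 by (auto simp: heis_bracket_def)
    moreover have "m = (if m < 0 then - int i else int i)" "n = (if n < 0 then - int j else int j)"
      using assms by (auto simp: i_def j_def)
    moreover have "i > 0" "j > 0" using assms by (auto simp: i_def j_def)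
    ultimately show ?thesis
      using ij ij[symmetric]
      by (cases "m < 0"; cases "n < 0")
         (simp_all add: app_heis_op algebra_simps fun_upd_twist[OF ij])
  qed
qed

definition vac_state :: state where
  "vac_state e = (if e = (\<lambda>_. 0) then 1 else 0)"

lemma heis_op_vac: "n > 0 \<Longrightarrow> app (heis_op q1 q2 n) vac_state = (\<lambda>e. 0)"
  by (auto simp: fun_eq_iff app_heis_op vac_state_def)

lemma heis_op_creation_at_0: "n < 0 \<Longrightarrow> app (heis_op q1 q2 n) s (\<lambda>_. 0) = 0"
  by (simp add: app_heis_op)

definition heis_rep :: "complex \<Rightarrow> complex \<Rightarrow> free_alg \<Rightarrow> endo" where
  "heis_rep q1 q2 = monoid_alg_ext scalar_endo
     (\<lambda>u. prod_list (map (\<lambda>m. heis_op q1 q2 (Rep_mode m)) (letters u)))"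

lemma heis_rep_add: "heis_rep q1 q2 (x + y) = heis_rep q1 q2 x + heis_rep q1 q2 y"
  unfolding heis_rep_def by (rule monoid_alg_ext_add) (simp_all add: scalar_endo_arith)

lemma heis_rep_mult: "heis_rep q1 q2 (x * y) = heis_rep q1 q2 x * heis_rep q1 q2 y"
  unfolding heis_rep_def
  by (rule monoid_alg_ext_mult) (simp_all add: scalar_endo_arith plus_fword_def, rule scalar_endo_commute)

lemma heis_rep_cst [simp]: "heis_rep q1 q2 (cst k) = scalar_endo k"
  by (simp add: heis_rep_def monoid_alg_ext_single cst_def zero_fword_def)

lemma heis_rep_0 [simp]: "heis_rep q1 q2 0 = 0"
  by (simp add: heis_rep_def)

lemma heis_rep_1 [simp]: "heis_rep q1 q2 1 = 1"
  using heis_rep_cst[of q1 q2 1] by (simp add: cst_def)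

lemma heis_rep_mode_gen [simp]: "n \<noteq> 0 \<Longrightarrow> heis_rep q1 q2 (mode_gen n) = heis_op q1 q2 n"
  by (simp add: heis_rep_def monoid_alg_ext_single mode_gen_def Abs_mode_inverse)

lemma heis_rep_uminus: "heis_rep q1 q2 (- x) = - heis_rep q1 q2 x"
  using heis_rep_add[of q1 q2 x "-x"] by (simp add: eq_neg_iff_add_eq_0 add.commute)

lemma heis_rep_diff: "heis_rep q1 q2 (x - y) = heis_rep q1 q2 x - heis_rep q1 q2 y"
  using heis_rep_add[of q1 q2 "x - y" y] by (simp add: eq_diff_eq)

lemma heis_rep_sum: "heis_rep q1 q2 (\<Sum>i\<in>I. x i) = (\<Sum>i\<in>I. heis_rep q1 q2 (x i))"
  by (induction I rule: infinite_finite_induct) (simp_all add: heis_rep_add)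

text \<open>The representation respects the relations, and derivatives annihilate the constant \<open>1\<close>.  Hence
  applying an element of the free algebra to the constant \<open>1\<close> gives a well-defined map on the Fock
  space.\<close>

lemma heis_rep_null:
  assumes "x \<in> fock_null q1 q2"
  shows "app (heis_rep q1 q2 x) vac_state = (\<lambda>e. 0)"
  using assms
proof induction
  case zero
  show ?case by simp
next
  case (add x y)
  thus ?case by (simp add: heis_rep_add)
next
  case (comm m n x y)
  have "heis_rep q1 q2 (mode_gen m * mode_gen n - mode_gen n * mode_gen m
          - cst (heis_bracket q1 q2 m n)) = 0"
    unfolding heis_rep_diff heis_rep_mult
    using comm heis_op_commutator[of m n q1 q2] by simp
  hence "heis_rep q1 q2 (x * (mode_gen m * mode_gen n - mode_gen n * mode_gen m
          - cst (heis_bracket q1 q2 m n)) * y) = 0"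
    unfolding heis_rep_mult by simp
  thus ?case by simp
next
  case (annihil n x)
  thus ?case by (simp add: heis_rep_mult heis_op_vac)
qed

section \<open>The Fock space as a quotient\<close>

lemma fock_null_lmult: "x \<in> fock_null q1 q2 \<Longrightarrow> z * x \<in> fock_null q1 q2"
proof (induction rule: fock_null.induct)
  case zero
  show ?case by (simp add: fock_null.zero)
next
  case (add x y)
  thus ?case by (simp add: distrib_left fock_null.add)
next
  case (comm m n x y)
  thus ?case using fock_null.comm[of m n "z * x" q1 q2 y] by (simp add: mult.assoc)
next
  case (annihil n x)
  thus ?case using fock_null.annihil[of n "z * x" q1 q2] by (simp add: mult.assoc)
qed

lemma fock_null_uminus: "x \<in> fock_null q1 q2 \<Longrightarrow> - x \<in> fock_null q1 q2"
  using fock_null_lmult[of x q1 q2 "-1"] by simp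

lemma fock_null_diff:
  "x \<in> fock_null q1 q2 \<Longrightarrow> y \<in> fock_null q1 q2 \<Longrightarrow> x - y \<in> fock_null q1 q2"
  using fock_null.add[OF _ fock_null_uminus, of x q1 q2 y] by simp

lemma fock_null_sum:
  "(\<And>i. i \<in> I \<Longrightarrow> x i \<in> fock_null q1 q2) \<Longrightarrow> (\<Sum>i\<in>I. x i) \<in> fock_null q1 q2"
  by (induction I rule: infinite_finite_induct) (auto intro: fock_null.intros)

lemma fock_null_diff_commute: "x - y \<in> fock_null q1 q2 \<longleftrightarrow> y - x \<in> fock_null q1 q2"
  using fock_null_uminus[of "x - y" q1 q2] fock_null_uminus[of "y - x" q1 q2] by auto

lemma fock_null_diff_trans:
  "x - y \<in> fock_null q1 q2 \<Longrightarrow> y - z \<in> fock_null q1 q2 \<Longrightarrow> x - z \<in> fock_null q1 q2"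
  using fock_null.add[of "x - y" q1 q2 "y - z"] by simp

lemma mem_fock_class: "x \<in> fock_class q1 q2 x"
  by (simp add: fock_class_def fock_null.zero)

lemma fock_class_eq_iff: "fock_class q1 q2 x = fock_class q1 q2 y \<longleftrightarrow> x - y \<in> fock_null q1 q2"
proof
  assume "fock_class q1 q2 x = fock_class q1 q2 y"
  hence "x \<in> fock_class q1 q2 y" using mem_fock_class by metis
  thus "x - y \<in> fock_null q1 q2" by (simp add: fock_class_def)
next
  assume "x - y \<in> fock_null q1 q2"
  thus "fock_class q1 q2 x = fock_class q1 q2 y"
    unfolding fock_class_def by (auto intro: fock_null_diff_trans simp: fock_null_diff_commute[of x])
qed

text \<open>Operators on the Fock space are defined as unions over all representatives; for maps that respect
  the null space a single representative suffices.\<close>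

lemma union_fock_class:
  assumes "\<And>y. y - x \<in> fock_null q1 q2 \<Longrightarrow> f y - f x \<in> fock_null q1 q2"
  shows "(\<Union>y\<in>fock_class q1 q2 x. fock_class q1 q2 (f y)) = fock_class q1 q2 (f x)"
proof -
  have "fock_class q1 q2 (f y) = fock_class q1 q2 (f x)" if "y \<in> fock_class q1 q2 x" for y
    using that assms by (simp add: fock_class_def[of _ _ x] fock_class_eq_iff)
  thus ?thesis using mem_fock_class by blast
qed

lemma heis_act_fock_class: "heis_act q1 q2 z (fock_class q1 q2 x) = fock_class q1 q2 (z * x)"
  unfolding heis_act_def
  by (rule union_fock_class) (use fock_null_lmult in \<open>fastforce simp: right_diff_distrib\<close>)

subsection \<open>Normal ordering\<close>

definition total_mode :: "mode fword \<Rightarrow> int" where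
  "total_mode u = (\<Sum>m\<leftarrow>letters u. Rep_mode m)"

definition creation_word :: "mode fword \<Rightarrow> bool" where
  "creation_word u \<longleftrightarrow> (\<forall>m\<in>set (letters u). Rep_mode m < 0)"

text \<open>The elements that are, modulo the null space, combinations of words in creation operators with
  mode numbers adding up to \<open>d\<close>.\<close>

definition normal_orderable :: "complex \<Rightarrow> complex \<Rightarrow> int \<Rightarrow> free_alg set" where
  "normal_orderable q1 q2 d =
     {x. \<exists>y. x - y \<in> fock_null q1 q2 \<and> (\<forall>u\<in>Poly_Mapping.keys y. creation_word u \<and> total_mode u = d)}"

lemma total_mode_add [simp]: "total_mode (u + v) = total_mode u + total_mode v"
  by (simp add: total_mode_def plus_fword_def)

lemma creation_word_add [simp]: "creation_word (u + v) \<longleftrightarrow> creation_word u \<and> creation_word v"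
  by (auto simp: creation_word_def plus_fword_def)

lemma total_mode_FWord_simps [simp]:
  "total_mode (FWord []) = 0" "total_mode (FWord (m # ms)) = Rep_mode m + total_mode (FWord ms)"
  "total_mode 0 = 0"
  by (simp_all add: total_mode_def zero_fword_def)

lemma creation_word_FWord_simps [simp]:
  "creation_word (FWord [])" "creation_word 0"
  "creation_word (FWord (m # ms)) \<longleftrightarrow> Rep_mode m < 0 \<and> creation_word (FWord ms)"
  by (simp_all add: creation_word_def zero_fword_def)

lemma cst_mult_commute: "x * cst k = cst k * (x :: 'm::monoid_add \<Rightarrow>\<^sub>0 complex)"
  by (induction x rule: poly_mapping_additive_induct)
     (simp_all add: cst_def mult_single distrib_left distrib_right mult.commute)

lemma single_eq_cst_mult: "Poly_Mapping.single u k = cst k * Poly_Mapping.single u 1"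
  by (simp add: cst_def mult_single)

lemma single_Cons: "Poly_Mapping.single (FWord (m # ms)) 1 =
    mode_gen (Rep_mode m) * Poly_Mapping.single (FWord ms) 1"
  by (simp add: mode_gen_def mult_single plus_fword_def Rep_mode_inverse)

lemma single_FWord_Nil: "Poly_Mapping.single (FWord []) 1 = (1 :: free_alg)"
  by (simp flip: zero_fword_def)

lemma normal_orderable_null: "x \<in> fock_null q1 q2 \<Longrightarrow> x \<in> normal_orderable q1 q2 d"
  unfolding normal_orderable_def by (auto intro!: exI[of _ 0])

lemma normal_orderable_add:
  assumes "x \<in> normal_orderable q1 q2 d" "y \<in> normal_orderable q1 q2 d"
  shows "x + y \<in> normal_orderable q1 q2 d"
proof -
  obtain x' y' where *: "x - x' \<in> fock_null q1 q2" "y - y' \<in> fock_null q1 q2"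
    "\<forall>u\<in>Poly_Mapping.keys x'. creation_word u \<and> total_mode u = d"
    "\<forall>u\<in>Poly_Mapping.keys y'. creation_word u \<and> total_mode u = d"
    using assms unfolding normal_orderable_def by blast
  have "x + y - (x' + y') \<in> fock_null q1 q2"
    using fock_null.add[OF *(1,2)] by (simp add: algebra_simps)
  thus ?thesis unfolding normal_orderable_def using *(3,4) keys_add[of x' y'] by blast
qed

lemma normal_orderable_cong:
  "x - y \<in> fock_null q1 q2 \<Longrightarrow> y \<in> normal_orderable q1 q2 d \<Longrightarrow> x \<in> normal_orderable q1 q2 d"
  using normal_orderable_add[OF normal_orderable_null, of "x - y" q1 q2 y d] by simp

lemma normal_orderable_sum:
  "(\<And>i. i \<in> I \<Longrightarrow> x i \<in> normal_orderable q1 q2 d) \<Longrightarrow> (\<Sum>i\<in>I. x i) \<in> normal_orderable q1 q2 d"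
  by (induction I rule: infinite_finite_induct)
     (auto intro: normal_orderable_add normal_orderable_null fock_null.zero)

lemma normal_orderable_creation:
  assumes "x \<in> normal_orderable q1 q2 d" "\<forall>u\<in>Poly_Mapping.keys z. creation_word u \<and> total_mode u = d'"
  shows "z * x \<in> normal_orderable q1 q2 (d' + d)"
proof -
  obtain y where *: "x - y \<in> fock_null q1 q2"
    "\<forall>u\<in>Poly_Mapping.keys y. creation_word u \<and> total_mode u = d"
    using assms unfolding normal_orderable_def by blast
  have "z * x - z * y \<in> fock_null q1 q2"
    using fock_null_lmult[OF *(1)] by (simp add: right_diff_distrib)
  moreover have "\<forall>u\<in>Poly_Mapping.keys (z * y). creation_word u \<and> total_mode u = d' + d"
    using keys_mult[of z y] *(2) assms(2) by auto
  ultimately show ?thesis unfolding normal_orderable_def by blast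
qed

lemma normal_orderable_cst:
  "x \<in> normal_orderable q1 q2 d \<Longrightarrow> cst k * x \<in> normal_orderable q1 q2 d"
  using normal_orderable_creation[of x q1 q2 d "cst k" 0] by (auto simp: cst_def split: if_splits)

lemma normal_orderable_mode_creation:
  assumes "x \<in> normal_orderable q1 q2 d" "m < 0"
  shows "mode_gen m * x \<in> normal_orderable q1 q2 (m + d)"
  by (rule normal_orderable_creation[OF assms(1)])
     (use assms(2) in \<open>auto simp: mode_gen_def Abs_mode_inverse\<close>)

text \<open>Commute the annihilation operator to the right, where it annihilates the vacuum.  Each commutator
  met on the way is a scalar, nonzero only if the two modes are opposite, so that dropping both
  letters preserves the sum of the mode numbers.\<close>

lemma normal_orderable_annihilation_word:
  assumes "m > 0" "creation_word (FWord ms)"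
  shows "mode_gen m * Poly_Mapping.single (FWord ms) 1
           \<in> normal_orderable q1 q2 (m + total_mode (FWord ms))"
  using assms(2)
proof (induction ms)
  case Nil
  show ?case using fock_null.annihil[OF assms(1), of 1 q1 q2]
    by (simp add: single_FWord_Nil normal_orderable_null)
next
  case (Cons k ks)
  let ?k = "Rep_mode k" and ?w = "Poly_Mapping.single (FWord ks) 1 :: free_alg"
  have k: "?k < 0" using Cons by simp
  have "1 * (mode_gen m * mode_gen ?k - mode_gen ?k * mode_gen m
       - cst (heis_bracket q1 q2 m ?k)) * ?w \<in> fock_null q1 q2"
    by (rule fock_null.comm) (use assms k in auto)
  hence "mode_gen m * (mode_gen ?k * ?w) -
      (mode_gen ?k * (mode_gen m * ?w) + cst (heis_bracket q1 q2 m ?k) * ?w) \<in> fock_null q1 q2"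
    by (simp add: algebra_simps)
  moreover have "mode_gen ?k * (mode_gen m * ?w) \<in> normal_orderable q1 q2 (?k + (m + total_mode (FWord ks)))"
    by (rule normal_orderable_mode_creation) (use Cons k in auto)
  moreover have "cst (heis_bracket q1 q2 m ?k) * ?w \<in> normal_orderable q1 q2 (?k + (m + total_mode (FWord ks)))"
  proof (cases "m = - ?k")
    case True
    have "?w - ?w \<in> fock_null q1 q2" by (simp add: fock_null.zero)
    hence "?w \<in> normal_orderable q1 q2 (total_mode (FWord ks))"
      unfolding normal_orderable_def using Cons.prems
      by (intro CollectI exI[of _ ?w]) auto
    thus ?thesis using True by (simp add: normal_orderable_cst)
  qed (simp add: heis_bracket_def cst_def normal_orderable_null fock_null.zero)
  ultimately show ?case
    unfolding single_Cons total_mode_FWord_simps add.left_commute[of m ?k]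
    by (rule normal_orderable_cong[OF _ normal_orderable_add])
qed

lemma normal_orderable_mode:
  assumes "x \<in> normal_orderable q1 q2 d" "m \<noteq> 0"
  shows "mode_gen m * x \<in> normal_orderable q1 q2 (m + d)"
proof (cases "m < 0")
  case False
  hence m: "m > 0" using assms by simp
  obtain y where *: "x - y \<in> fock_null q1 q2"
    "\<forall>u\<in>Poly_Mapping.keys y. creation_word u \<and> total_mode u = d"
    using assms unfolding normal_orderable_def by blast
  let ?s = "\<lambda>u. cst (Poly_Mapping.lookup y u) * (mode_gen m * Poly_Mapping.single u 1)"
  have "mode_gen m * x = mode_gen m * (x - y) + mode_gen m * y"
    by (simp add: algebra_simps)
  also have "mode_gen m * y = (\<Sum>u\<in>Poly_Mapping.keys y. ?s u)"
  proof -
    have "mode_gen m * y = mode_gen m * (\<Sum>u\<in>Poly_Mapping.keys y. cst (Poly_Mapping.lookup y u) * Poly_Mapping.single u 1)"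
      by (subst (1) poly_mapping_eq_sum_single[of y]) (simp flip: single_eq_cst_mult)
    thus ?thesis by (simp add: sum_distrib_left cst_mult_commute flip: mult.assoc)
  qed
  finally have eq: "mode_gen m * x = mode_gen m * (x - y) + (\<Sum>u\<in>Poly_Mapping.keys y. ?s u)" .
  have "?s u \<in> normal_orderable q1 q2 (m + d)" if "u \<in> Poly_Mapping.keys y" for u
    using bspec[OF *(2) that] normal_orderable_annihilation_word[OF m, of "letters u" q1 q2]
    by (intro normal_orderable_cst) simp
  hence "(\<Sum>u\<in>Poly_Mapping.keys y. ?s u) \<in> normal_orderable q1 q2 (m + d)"
    by (rule normal_orderable_sum)
  thus ?thesis unfolding eq
    by (intro normal_orderable_add normal_orderable_null[OF fock_null_lmult[OF *(1)]])
qed (use assms normal_orderable_mode_creation in auto)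

lemma normal_orderable_word: "Poly_Mapping.single u 1 \<in> normal_orderable q1 q2 (total_mode u)"
proof -
  have "Poly_Mapping.single (FWord ms) 1 \<in> normal_orderable q1 q2 (total_mode (FWord ms))" for ms
  proof (induction ms)
    case Nil
    have "(1::free_alg) - 1 \<in> fock_null q1 q2" by (simp add: fock_null.zero)
    thus ?case unfolding single_FWord_Nil normal_orderable_def
      by (intro CollectI exI[of _ 1]) (auto simp: zero_fword_def[symmetric])
  next
    case (Cons m ms)
    thus ?case using Rep_mode[of m] by (simp add: single_Cons normal_orderable_mode)
  qed
  from this[of "letters u"] show ?thesis by simp
qed

lemma total_mode_nonpos: "creation_word u \<Longrightarrow> total_mode u \<le> 0"
proof -
  have "creation_word (FWord ms) \<Longrightarrow> total_mode (FWord ms) \<le> 0" for ms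
    by (induction ms) auto
  from this[of "letters u"] show "creation_word u \<Longrightarrow> total_mode u \<le> 0" by simp
qed

text \<open>A word in creation operators has a total mode number of at most \<open>0\<close>, so a normally ordered
  element of positive total mode number has no summands.\<close>

lemma positive_total_mode_null:
  assumes "\<And>u. u \<in> Poly_Mapping.keys x \<Longrightarrow> total_mode u > 0"
  shows "x \<in> fock_null q1 q2"
proof -
  have "Poly_Mapping.single u (Poly_Mapping.lookup x u) \<in> fock_null q1 q2"
    if "u \<in> Poly_Mapping.keys x" for u
  proof -
    obtain y where y: "Poly_Mapping.single u 1 - y \<in> fock_null q1 q2"
      "\<forall>v\<in>Poly_Mapping.keys y. creation_word v \<and> total_mode v = total_mode u"
      using normal_orderable_word[of u q1 q2] unfolding normal_orderable_def by blast
    have "Poly_Mapping.keys y = {}" using y(2) assms[OF that] total_mode_nonpos by fastforce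
    hence "Poly_Mapping.single u 1 \<in> fock_null q1 q2" using y(1) by simp
    thus ?thesis by (subst single_eq_cst_mult) (rule fock_null_lmult)
  qed
  thus ?thesis by (subst poly_mapping_eq_sum_single) (rule fock_null_sum)
qed

subsection \<open>The dual of the vacuum\<close>

text \<open>The constant term of the polynomial that represents a vector.\<close>

definition vacuum_expectation :: "complex \<Rightarrow> complex \<Rightarrow> free_alg \<Rightarrow> complex" where
  "vacuum_expectation q1 q2 x = app (heis_rep q1 q2 x) vac_state (\<lambda>_. 0)"

text \<open>Modulo the null space only creation words matter; a nonempty one starts with a creation operator,
  and the empty one is the vacuum.\<close>

lemma functional_vanishes:
  assumes add: "\<And>x y. \<psi> (x + y) = \<psi> x + (\<psi> y :: complex)"
    and scale: "\<And>k x. \<psi> (cst k * x) = k * \<psi> x"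
    and null: "\<And>x. x \<in> fock_null q1 q2 \<Longrightarrow> \<psi> x = 0"
    and creation: "\<And>n x. n < 0 \<Longrightarrow> \<psi> (mode_gen n * x) = 0"
    and vac: "\<psi> 1 = 0"
  shows "\<psi> x = 0"
proof -
  have diff: "\<psi> x = \<psi> y" if "x - y \<in> fock_null q1 q2" for x y
    using add[of "x - y" y] null[OF that] by simp
  have word: "\<psi> (Poly_Mapping.single u k) = 0" if "creation_word u" for u k
  proof -
    have "\<psi> (Poly_Mapping.single (FWord ms) 1) = 0" if "creation_word (FWord ms)" for ms
      using that by (cases ms) (auto simp: single_Cons creation vac single_FWord_Nil)
    from this[of "letters u"] have "\<psi> (Poly_Mapping.single u 1) = 0" using that by simp
    thus ?thesis by (subst single_eq_cst_mult) (simp add: scale)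
  qed
  have zero: "\<psi> 0 = 0" using null fock_null.zero by blast
  have sum: "\<psi> (\<Sum>i\<in>I. f i) = (\<Sum>i\<in>I. \<psi> (f i))" for I :: "mode fword set" and f
    by (induction I rule: infinite_finite_induct) (auto simp: add zero)
  have "\<psi> (Poly_Mapping.single u k) = 0" for u k
  proof -
    obtain y where y: "Poly_Mapping.single u 1 - y \<in> fock_null q1 q2"
      "\<forall>v\<in>Poly_Mapping.keys y. creation_word v"
      using normal_orderable_word[of u q1 q2] unfolding normal_orderable_def by blast
    have "\<psi> y = 0"
      by (subst poly_mapping_eq_sum_single) (use y(2) in \<open>simp add: sum word\<close>)
    hence "\<psi> (Poly_Mapping.single u 1) = 0" using diff[OF y(1)] by simp
    thus ?thesis by (subst single_eq_cst_mult) (simp add: scale)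
  qed
  thus ?thesis
    by (induction x rule: poly_mapping_additive_induct) (simp_all add: zero add)
qed

lemma vacuum_expectation_props:
  "vacuum_expectation q1 q2 (x + y) = vacuum_expectation q1 q2 x + vacuum_expectation q1 q2 y"
  "vacuum_expectation q1 q2 (cst k * x) = k * vacuum_expectation q1 q2 x"
  "x \<in> fock_null q1 q2 \<Longrightarrow> vacuum_expectation q1 q2 x = 0"
  "n < 0 \<Longrightarrow> vacuum_expectation q1 q2 (mode_gen n * x) = 0"
  "vacuum_expectation q1 q2 1 = 1"
  by (simp_all add: vacuum_expectation_def heis_rep_add heis_rep_mult heis_rep_null
      heis_op_creation_at_0) (simp add: vac_state_def)

text \<open>The constant term has all properties that characterise the dual of the vacuum, and
  \<open>functional_vanishes\<close>, applied to the difference of two candidates, shows that they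
  characterise it.\<close>

lemma vac_dual_fock_class: "vac_dual q1 q2 (fock_class q1 q2 x) = vacuum_expectation q1 q2 x"
proof -
  let ?is = "\<lambda>w. w \<in> fock_dual q1 q2 \<and> w (vac q1 q2) = 1 \<and>
    (\<forall>n>0. \<forall>X\<in>fock q1 q2. w (heis_act q1 q2 (mode_gen (- n)) X) = 0)"
  note ve = vacuum_expectation_props
  have ve_diff: "vacuum_expectation q1 q2 x = vacuum_expectation q1 q2 y"
    if "x - y \<in> fock_null q1 q2" for x y
    using ve(1)[of q1 q2 "x - y" y] ve(3)[OF that] by simp
  define w where "w = restrict (\<lambda>X. vacuum_expectation q1 q2 (SOME x. x \<in> X)) (fock q1 q2)"
  have w: "w (fock_class q1 q2 x) = vacuum_expectation q1 q2 x" for x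
  proof -
    have "(SOME y. y \<in> fock_class q1 q2 x) \<in> fock_class q1 q2 x"
      by (rule someI[of _ x]) (rule mem_fock_class)
    hence "(SOME y. y \<in> fock_class q1 q2 x) - x \<in> fock_null q1 q2" by (simp add: fock_class_def)
    thus ?thesis by (auto simp: w_def fock_def dest: ve_diff)
  qed
  have unique: "w' (fock_class q1 q2 x) = vacuum_expectation q1 q2 x" if "?is w'" for w' x
  proof -
    let ?\<psi> = "\<lambda>x. w' (fock_class q1 q2 x) - vacuum_expectation q1 q2 x"
    have add: "w' (fock_class q1 q2 (x + y)) = w' (fock_class q1 q2 x) + w' (fock_class q1 q2 y)"
      and scale: "w' (fock_class q1 q2 (cst k * x)) = k * w' (fock_class q1 q2 x)" for x y k
      using that by (auto simp: fock_dual_def)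
    have "w' (fock_class q1 q2 0) = 0" using add[of 0 0] by simp
    hence null: "w' (fock_class q1 q2 x) = 0" if "x \<in> fock_null q1 q2" for x
      using fock_class_eq_iff[of q1 q2 x 0] that by simp
    have creation: "w' (fock_class q1 q2 (mode_gen n * x)) = 0" if "n < 0" for n x
      using \<open>?is w'\<close>[THEN conjunct2, THEN conjunct2, rule_format, of "-n" "fock_class q1 q2 x"] that
      by (simp add: fock_def heis_act_fock_class)
    have "?\<psi> x = 0"
      by (rule functional_vanishes[of ?\<psi> q1 q2])
         (use that in \<open>simp_all add: add scale null creation ve vac_def algebra_simps\<close>)
    thus ?thesis by simp
  qed
  have "vac_dual q1 q2 = w"
    unfolding vac_dual_def
  proof (rule the_equality)
    show "?is w"
    proof (intro conjI allI impI ballI)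
      show "w \<in> fock_dual q1 q2" by (simp add: fock_dual_def w ve) (simp add: w_def)
      show "w (vac q1 q2) = 1" by (simp add: vac_def w ve)
      show "w (heis_act q1 q2 (mode_gen (- n)) X) = 0" if "n > 0" "X \<in> fock q1 q2" for n X
        using that by (auto simp: fock_def heis_act_fock_class w ve)
    qed
  next
    fix w' assume w': "?is w'"
    show "w' = w"
    proof (rule extensionalityI)
      show "w' \<in> extensional (fock q1 q2)" using w' by (simp add: fock_dual_def)
      show "w \<in> extensional (fock q1 q2)" by (simp add: w_def)
      show "w' X = w X" if "X \<in> fock q1 q2" for X
        using that unique[OF w'] w by (auto simp: fock_def)
    qed
  qed
  thus ?thesis by (simp add: w)
qed

section \<open>Exponentials of series of endomorphisms\<close>

definition exp_endo :: "endo fps \<Rightarrow> endo fps" where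
  "exp_endo B = fps_compose (Abs_fps (\<lambda>k. scalar_endo (1 / fact k))) B"

lemma exp_endo_nth: "fps_nth (exp_endo B) n = (\<Sum>i=0..n. scalar_endo (1 / fact i) * fps_nth (B ^ i) n)"
  by (simp add: exp_endo_def fps_compose_nth)

lemma heis_rep_fps_power:
  "heis_rep q1 q2 (fps_nth (B ^ i) n) = fps_nth (Abs_fps (\<lambda>n. heis_rep q1 q2 (fps_nth B n)) ^ i) n"
  by (induction i arbitrary: n) (simp_all add: fps_mult_nth heis_rep_sum heis_rep_mult)

lemma heis_rep_exp_series:
  "heis_rep q1 q2 (fps_nth (exp_series B) n) =
     fps_nth (exp_endo (Abs_fps (\<lambda>n. heis_rep q1 q2 (fps_nth B n)))) n"
  by (simp add: exp_endo_nth exp_series_def fps_compose_nth heis_rep_sum heis_rep_mult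
      heis_rep_fps_power)

lemma fps_power_nth_below:
  fixes B :: "'a::ring_1 fps"
  assumes "fps_nth B 0 = 0" "n < i"
  shows "fps_nth (B ^ i) n = 0"
  using assms(2)
proof (induction i arbitrary: n)
  case (Suc i)
  have "fps_nth B j * fps_nth (B ^ i) (n - j) = 0" if "j \<in> {0..n}" for j
    using that Suc assms(1) by (cases "j = 0") auto
  thus ?case by (simp add: fps_mult_nth)
qed simp

lemma fps_deriv_power_commuting:
  fixes B :: "'a::ring_1 fps"
  assumes "B * fps_deriv B = fps_deriv B * B"
  shows "fps_deriv (B ^ Suc i) = of_nat (Suc i) * (fps_deriv B * B ^ i)"
proof (induction i)
  case (Suc i)
  have "fps_deriv (B ^ Suc (Suc i)) = B * fps_deriv (B ^ Suc i) + fps_deriv B * B ^ Suc i"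
    by (subst power_Suc, subst fps_deriv_mult) simp
  also have "B * fps_deriv (B ^ Suc i) = of_nat (Suc i) * (fps_deriv B * B ^ Suc i)"
    unfolding Suc by (metis (no_types, lifting) assms mult.assoc mult_of_nat_commute power_Suc)
  finally show ?case by (simp add: algebra_simps)
qed simp

text \<open>The coefficients of the exponent have to commute so that the derivative of a power has its usual
  form.  The exchange relations below are derived from this linear equation.\<close>

lemma fps_deriv_exp_endo:
  assumes "fps_nth B 0 = 0" "\<And>i j. fps_nth B i * fps_nth B j = fps_nth B j * fps_nth B i"
  shows "fps_deriv (exp_endo B) = fps_deriv B * exp_endo B"
proof (rule fps_ext)
  fix n
  have comm: "B * fps_deriv B = fps_deriv B * B"
  proof (rule fps_ext)
    fix n
    have *: "fps_nth B i * (of_nat m * fps_nth B j) = of_nat m * fps_nth B j * fps_nth B i" for i j m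
      by (metis assms(2) mult.assoc mult_of_nat_commute)
    show "fps_nth (B * fps_deriv B) n = fps_nth (fps_deriv B * B) n"
      unfolding fps_mult_nth fps_deriv_nth *
      by (rule sum.reindex_bij_witness[of _ "\<lambda>i. n - i" "\<lambda>i. n - i"]) auto
  qed
  let ?c = "\<lambda>i. scalar_endo (1 / fact i)"
  have "fps_nth (fps_deriv (exp_endo B)) n =
      (\<Sum>i=0..Suc n. of_nat (n + 1) * (?c i * fps_nth (B ^ i) (n + 1)))"
    unfolding fps_deriv_nth exp_endo_nth sum_distrib_left by simp
  also have "\<dots> = (\<Sum>i=0..Suc n. ?c i * fps_nth (fps_deriv (B ^ i)) n)"
    unfolding fps_deriv_nth
    by (intro sum.cong refl) (metis (no_types, opaque_lifting) mult.assoc mult_of_nat_commute)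
  also have "\<dots> = (\<Sum>i=0..n. ?c (Suc i) * fps_nth (fps_deriv (B ^ Suc i)) n)"
    by (subst sum.atLeast0_atMost_Suc_shift)
       (simp del: power_Suc fps_deriv_nth fact_Suc of_nat_Suc fps_deriv_mult)
  also have "\<dots> = (\<Sum>i=0..n. ?c i * fps_nth (fps_deriv B * B ^ i) n)"
  proof (rule sum.cong[OF refl])
    fix i
    have c: "?c (Suc i) * of_nat (Suc i) = ?c i"
      by (simp flip: scalar_endo_of_nat scalar_endo_arith del: of_nat_Suc)
    have nth: "fps_nth (of_nat (Suc i) * F) n = of_nat (Suc i) * fps_nth F n" for F :: "endo fps"
      by (metis fps_mult_left_const_nth fps_of_nat)
    show "?c (Suc i) * fps_nth (fps_deriv (B ^ Suc i)) n = ?c i * fps_nth (fps_deriv B * B ^ i) n"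
      unfolding fps_deriv_power_commuting[OF comm] nth mult.assoc[of "?c (Suc i)", symmetric] c ..
  qed
  also have "\<dots> = (\<Sum>k=0..n. \<Sum>i=0..n. ?c i * (fps_nth (fps_deriv B) k * fps_nth (B ^ i) (n - k)))"
    unfolding fps_mult_nth sum_distrib_left by (rule sum.swap)
  also have "\<dots> = (\<Sum>k=0..n. \<Sum>i=0..n-k. ?c i * (fps_nth (fps_deriv B) k * fps_nth (B ^ i) (n - k)))"
    by (intro sum.cong refl sum.mono_neutral_right) (auto simp: fps_power_nth_below assms(1))
  also have "\<dots> = fps_nth (fps_deriv B * exp_endo B) n"
    unfolding fps_mult_nth exp_endo_nth sum_distrib_left
    by (intro sum.cong refl) (metis (no_types, opaque_lifting) mult.assoc scalar_endo_commute)
  finally show "fps_nth (fps_deriv (exp_endo B)) n = fps_nth (fps_deriv B * exp_endo B) n" .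
qed

lemma exp_endo_commute:
  assumes "\<And>n. x * fps_nth B n = fps_nth B n * x"
  shows "x * fps_nth (exp_endo B) n = fps_nth (exp_endo B) n * x"
proof -
  have pow: "x * fps_nth (B ^ i) n = fps_nth (B ^ i) n * x" for i n
  proof (induction i arbitrary: n)
    case (Suc i)
    show ?case
      unfolding power_Suc fps_mult_nth sum_distrib_left sum_distrib_right
      by (intro sum.cong refl) (metis Suc assms mult.assoc)
  qed simp
  show ?thesis
    unfolding exp_endo_nth sum_distrib_left sum_distrib_right
    by (intro sum.cong refl) (metis pow mult.assoc scalar_endo_commute)
qed

text \<open>The coefficients of a solution are determined one by one, as positive integers can be cancelled.
  This is stated for an arbitrary ring since it is used both for series of endomorphisms and for
  series whose coefficients are such series.\<close>

lemma fps_linear_ode_zero: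
  fixes H P :: "'a::ring_1 fps"
  assumes torsion_free: "\<And>n x::'a. of_nat (Suc n) * x = 0 \<Longrightarrow> x = 0"
    and "fps_deriv H = P * H" "fps_nth H 0 = 0"
  shows "H = 0"
proof (rule fps_ext)
  fix n show "fps_nth H n = fps_nth 0 n"
  proof (induction n rule: less_induct)
    case (less n)
    show ?case
    proof (cases n)
      case (Suc m)
      have "of_nat (Suc m) * fps_nth H (Suc m) = fps_nth (P * H) m"
        by (simp flip: assms(2))
      also have "\<dots> = 0"
        unfolding fps_mult_nth by (rule sum.neutral) (use less Suc in auto)
      finally show ?thesis using torsion_free Suc by simp
    qed (use assms in simp)
  qed
qed

lemma endo_torsion_free: "of_nat (Suc n) * (x :: endo) = 0 \<Longrightarrow> x = 0"
proof -
  assume "of_nat (Suc n) * x = 0"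
  hence "scalar_endo (1 / of_nat (Suc n)) * (scalar_endo (of_nat (Suc n)) * x) = 0"
    by (simp only: scalar_endo_of_nat) simp
  thus "x = 0" by (simp flip: mult.assoc scalar_endo_arith del: of_nat_Suc)
qed

lemma endo_fps_torsion_free: "of_nat (Suc n) * (x :: endo fps) = 0 \<Longrightarrow> x = 0"
  by (rule fps_ext) (metis endo_torsion_free fps_mult_left_const_nth fps_of_nat fps_zero_nth)

text \<open>The central element \<open>k y\<^sup>m\<close> of the ring of power series in \<open>y\<close> over the endomorphisms.\<close>

definition monomial :: "complex \<Rightarrow> nat \<Rightarrow> endo fps" where
  "monomial k m = Abs_fps (\<lambda>n. if n = m then scalar_endo k else 0)"

lemma monomial_mult_nth:
  "fps_nth (monomial k m * f) n = (if m \<le> n then scalar_endo k * fps_nth f (n - m) else 0)"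
  by (auto simp: monomial_def fps_mult_nth if_distrib[of "\<lambda>x. x * _"] sum.delta cong: if_cong)

lemma mult_monomial_nth:
  "fps_nth (f * monomial k m) n = (if m \<le> n then scalar_endo k * fps_nth f (n - m) else 0)"
proof -
  have *: "n - i = m \<longleftrightarrow> m \<le> n \<and> i = n - m" if "i \<le> n" for i using that by auto
  have "fps_nth (f * monomial k m) n = (\<Sum>i=0..n. if m \<le> n \<and> i = n - m then scalar_endo k * fps_nth f i else 0)"
    unfolding fps_mult_nth monomial_def
    by (intro sum.cong refl) (auto simp: * scalar_endo_commute)
  thus ?thesis by (auto simp: sum.delta cong: if_cong)
qed

lemma monomial_commute: "f * monomial k m = monomial k m * f"
  by (rule fps_ext) (simp add: monomial_mult_nth mult_monomial_nth)

lemma monomial_mult: "monomial k m * monomial l n = monomial (k * l) (m + n)"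
  by (rule fps_ext) (auto simp: monomial_mult_nth, auto simp: monomial_def scalar_endo_arith)

lemma monomial_add: "monomial (k + l) m = monomial k m + monomial l m"
  by (rule fps_ext) (simp add: monomial_def scalar_endo_arith)

lemma monomial_sum: "monomial (\<Sum>i\<in>I. k i) m = (\<Sum>i\<in>I. monomial (k i) m)"
proof (induction I rule: infinite_finite_induct)
  case empty
  show ?case by (rule fps_ext) (simp add: monomial_def)
qed (simp_all add: monomial_add, simp add: monomial_def fps_eq_iff)

lemma of_nat_mult_monomial: "of_nat n * monomial k m = monomial (of_nat n * k) m"
proof -
  have "of_nat n = monomial (of_nat n) 0"
    by (rule fps_ext) (auto simp: monomial_def scalar_endo_of_nat simp flip: fps_of_nat)
  thus ?thesis by (simp add: monomial_mult)
qed

section \<open>The vertex operator in the representation\<close>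

definition creation_coeff :: "complex \<Rightarrow> complex \<Rightarrow> nat \<Rightarrow> endo" where
  "creation_coeff q1 q2 n = heis_rep q1 q2 (fps_nth (vertex_creation q2) n)"

definition annihilation_coeff :: "complex \<Rightarrow> complex \<Rightarrow> nat \<Rightarrow> endo" where
  "annihilation_coeff q1 q2 n = heis_rep q1 q2 (fps_nth (vertex_annihilation q2) n)"

definition creation_exponent :: "complex \<Rightarrow> complex \<Rightarrow> endo fps" where
  "creation_exponent q1 q2 = Abs_fps (\<lambda>n. if n = 0 then 0
     else scalar_endo ((1 - q2 ^ n) / of_nat n) * heis_op q1 q2 (- int n))"

definition annihilation_exponent :: "complex \<Rightarrow> complex \<Rightarrow> endo fps" where
  "annihilation_exponent q1 q2 = Abs_fps (\<lambda>n. if n = 0 then 0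
     else scalar_endo (- (1 - q2 powi (- int n)) / of_nat n) * heis_op q1 q2 (int n))"

lemma scalar_endo_uminus: "scalar_endo (- k) = - scalar_endo k"
  using scalar_endo_arith(1)[of k "-k"] by (simp add: eq_neg_iff_add_eq_0 add.commute)

lemma creation_coeff_eq: "Abs_fps (creation_coeff q1 q2) = exp_endo (creation_exponent q1 q2)"
  by (rule fps_ext)
     (auto simp: creation_coeff_def vertex_creation_def heis_rep_exp_series creation_exponent_def
        heis_rep_mult intro!: arg_cong[of _ _ "\<lambda>B. fps_nth (exp_endo B) _"] fps_ext)

lemma annihilation_coeff_eq:
  "Abs_fps (annihilation_coeff q1 q2) = exp_endo (annihilation_exponent q1 q2)"
proof -
  have *: "scalar_endo ((a - 1) / b) = - scalar_endo ((1 - a) / b)" for a b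
    using scalar_endo_uminus[of "(1 - a) / b"] by (simp add: minus_divide_left)
  show ?thesis
    by (rule fps_ext)
       (auto simp: annihilation_coeff_def vertex_annihilation_def heis_rep_exp_series
        annihilation_exponent_def heis_rep_mult heis_rep_uminus *
        intro!: arg_cong[of _ _ "\<lambda>B. fps_nth (exp_endo B) _"] fps_ext)
qed

lemma heis_op_commute:
  assumes "m \<noteq> 0" "n \<noteq> 0" "m \<noteq> - n"
  shows "heis_op q1 q2 m * heis_op q1 q2 n = heis_op q1 q2 n * heis_op q1 q2 m"
  using heis_op_commutator[OF assms(1,2), of q1 q2] assms(3) by (simp add: heis_bracket_def)

lemma scalar_mult_commute:
  assumes "x * y = y * (x :: endo)"
  shows "scalar_endo k * x * (scalar_endo l * y) = scalar_endo l * y * (scalar_endo k * x)"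
  by (metis assms mult.assoc scalar_endo_commute)

lemma creation_exponent_commute:
  "fps_nth (creation_exponent q1 q2) i * fps_nth (creation_exponent q1 q2) j =
   fps_nth (creation_exponent q1 q2) j * fps_nth (creation_exponent q1 q2) i"
  by (auto simp: creation_exponent_def intro!: scalar_mult_commute heis_op_commute)

lemma annihilation_exponent_commute:
  "fps_nth (annihilation_exponent q1 q2) i * fps_nth (annihilation_exponent q1 q2) j =
   fps_nth (annihilation_exponent q1 q2) j * fps_nth (annihilation_exponent q1 q2) i"
  by (auto simp: annihilation_exponent_def intro!: scalar_mult_commute heis_op_commute)

lemma creation_ode: "fps_deriv (Abs_fps (creation_coeff q1 q2)) =
    fps_deriv (creation_exponent q1 q2) * Abs_fps (creation_coeff q1 q2)"
  unfolding creation_coeff_eq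
  by (rule fps_deriv_exp_endo) (rule creation_exponent_commute | simp add: creation_exponent_def)+

lemma annihilation_ode: "fps_deriv (Abs_fps (annihilation_coeff q1 q2)) =
    fps_deriv (annihilation_exponent q1 q2) * Abs_fps (annihilation_coeff q1 q2)"
  unfolding annihilation_coeff_eq
  by (rule fps_deriv_exp_endo) (rule annihilation_exponent_commute | simp add: annihilation_exponent_def)+

lemma annihilation_coeff_commute:
  "annihilation_coeff q1 q2 i * annihilation_coeff q1 q2 j =
   annihilation_coeff q1 q2 j * annihilation_coeff q1 q2 i"
proof -
  have eq: "annihilation_coeff q1 q2 n = fps_nth (exp_endo (annihilation_exponent q1 q2)) n" for n
    by (simp flip: annihilation_coeff_eq)
  have "fps_nth (annihilation_exponent q1 q2) m * annihilation_coeff q1 q2 n =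
        annihilation_coeff q1 q2 n * fps_nth (annihilation_exponent q1 q2) m" for m n
    unfolding eq by (rule exp_endo_commute) (rule annihilation_exponent_commute)
  thus ?thesis unfolding eq[of j] by (intro exp_endo_commute) simp
qed

lemma vertex_coeff_0 [simp]: "creation_coeff q1 q2 0 = 1" "annihilation_coeff q1 q2 0 = 1"
  using creation_coeff_eq[of q1 q2, THEN arg_cong[where f = "\<lambda>f. fps_nth f 0"]]
    annihilation_coeff_eq[of q1 q2, THEN arg_cong[where f = "\<lambda>f. fps_nth f 0"]]
  by (simp_all add: exp_endo_nth)

text \<open>Commuting \<open>a\<^sub>m\<close> with the exponent of \<open>C(y)\<close> gives the central monomial \<open>k y\<^sup>m\<close>.  Hence
  \<open>[a\<^sub>m, C(y)]\<close> and \<open>k y\<^sup>m C(y)\<close> differ by a solution of the linear equation of \<open>C\<close> with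
  vanishing constant term.\<close>

lemma annihilation_op_creation_coeff:
  assumes "m > 0"
  shows "fps_const (heis_op q1 q2 (int m)) * Abs_fps (creation_coeff q1 q2) =
    Abs_fps (creation_coeff q1 q2) * fps_const (heis_op q1 q2 (int m)) +
    monomial ((1 - q2 ^ m) / of_nat m * heis_bracket q1 q2 (int m) (- int m)) m *
      Abs_fps (creation_coeff q1 q2)"
proof -
  define a where "a = fps_const (heis_op q1 q2 (int m))"
  define C where "C = Abs_fps (creation_coeff q1 q2)"
  define P where "P = fps_deriv (creation_exponent q1 q2)"
  define k where "k = (1 - q2 ^ m) / of_nat m * heis_bracket q1 q2 (int m) (- int m)"
  define T where "T = monomial k m"
  have da: "fps_deriv a = 0" by (simp add: a_def)
  have dC: "fps_deriv C = P * C" unfolding C_def P_def by (rule creation_ode)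
  have aP: "a * P = P * a + fps_deriv T"
  proof (rule fps_ext)
    fix n
    let ?c = "of_nat (Suc n) * ((1 - q2 ^ Suc n) / of_nat (Suc n))"
    have "fps_nth P n = scalar_endo (of_nat (Suc n)) *
        (scalar_endo ((1 - q2 ^ Suc n) / of_nat (Suc n)) * heis_op q1 q2 (- int (Suc n)))"
      unfolding P_def fps_deriv_nth creation_exponent_def
      by (simp add: scalar_endo_of_nat del: of_nat_Suc power_Suc)
    hence P: "fps_nth P n = scalar_endo ?c * heis_op q1 q2 (- int (Suc n))"
      by (simp only: scalar_endo_arith mult.assoc)
    have comm: "heis_op q1 q2 (int m) * heis_op q1 q2 (- int (Suc n)) =
       heis_op q1 q2 (- int (Suc n)) * heis_op q1 q2 (int m)
        + scalar_endo (heis_bracket q1 q2 (int m) (- int (Suc n)))"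
      using heis_op_commutator[of "int m" "- int (Suc n)" q1 q2] assms by (simp add: algebra_simps)
    have T: "fps_nth (fps_deriv T) n = scalar_endo (?c * heis_bracket q1 q2 (int m) (- int (Suc n)))"
      using assms unfolding T_def fps_deriv_nth k_def monomial_def
      by (auto simp: heis_bracket_def mult_ac simp flip: scalar_endo_of_nat scalar_endo_arith)
    have "fps_nth (a * P) n = scalar_endo ?c * (heis_op q1 q2 (int m) * heis_op q1 q2 (- int (Suc n)))"
      unfolding a_def fps_mult_left_const_nth P by (metis mult.assoc scalar_endo_commute)
    also have "\<dots> = fps_nth (P * a + fps_deriv T) n"
      unfolding comm fps_add_nth T a_def fps_mult_right_const_nth P
      by (simp only: distrib_left scalar_endo_arith mult.assoc)
    finally show "fps_nth (a * P) n = fps_nth (P * a + fps_deriv T) n" .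
  qed
  define H where "H = a * C - C * a - T * C"
  have "fps_deriv H = P * H"
  proof -
    have "fps_deriv H = a * P * C - P * C * a - (T * P * C + fps_deriv T * C)"
      unfolding H_def by (simp add: da dC mult.assoc)
    also have "T * P = P * T" unfolding T_def by (rule monomial_commute[symmetric])
    finally show ?thesis unfolding aP H_def by (simp add: algebra_simps)
  qed
  moreover have "fps_nth H 0 = 0"
    unfolding H_def a_def C_def T_def using assms by (simp add: monomial_def)
  ultimately have "H = 0" by (rule fps_linear_ode_zero[rotated]) (rule endo_torsion_free)
  thus ?thesis unfolding H_def a_def C_def T_def k_def by (simp add: algebra_simps)
qed

section \<open>The contraction of two vertex operators\<close>

text \<open>The expansion of \<open>g(t) = (1 - t) (1 - q1 q2 t) / ((1 - q1 t) (1 - q2 t))\<close>.\<close>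

definition contraction :: "complex \<Rightarrow> complex \<Rightarrow> complex fps" where
  "contraction q1 q2 = (1 - fps_X) * (1 - fps_const (q1 * q2) * fps_X) *
     (Abs_fps (\<lambda>n. q1 ^ n) * Abs_fps (\<lambda>n. q2 ^ n))"

text \<open>The logarithmic derivative of \<open>g\<close> is a sum of four geometric series, and
  \<open>q1\<^sup>m + q2\<^sup>m - 1 - (q1 q2)\<^sup>m = - (1 - q1\<^sup>m) (1 - q2\<^sup>m)\<close>.\<close>

lemma contraction_ode:
  "fps_deriv (contraction q1 q2) =
     Abs_fps (\<lambda>n. - (1 - q1 ^ Suc n) * (1 - q2 ^ Suc n)) * contraction q1 q2"
proof -
  define geo where "geo = (\<lambda>q::complex. Abs_fps (\<lambda>n. q ^ n))"
  define L where "L = (\<lambda>q::complex. Abs_fps (\<lambda>n. q ^ Suc n))"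
  have geo: "fps_deriv (geo q) = L q * geo q" for q
  proof (rule fps_ext)
    fix n
    have "q ^ Suc i * q ^ (n - i) = q ^ Suc n" if "i \<le> n" for i
      using that by (simp flip: power_add)
    thus "fps_nth (fps_deriv (geo q)) n = fps_nth (L q * geo q) n"
      by (simp add: geo_def L_def fps_mult_nth del: power_Suc)
  qed
  have lin: "fps_deriv (1 - fps_const q * fps_X) = - L q * (1 - fps_const q * fps_X)" for q
  proof (rule fps_ext)
    fix n
    have "L q * (1 - fps_const q * fps_X) = L q - fps_const q * (fps_X * L q)"
      by (simp add: algebra_simps)
    thus "fps_nth (fps_deriv (1 - fps_const q * fps_X)) n = fps_nth (- L q * (1 - fps_const q * fps_X)) n"
      by (cases n) (simp_all add: L_def)
  qed
  define a b :: "complex fps" where "a = 1 - fps_const 1 * fps_X" and "b = 1 - fps_const (q1 * q2) * fps_X"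
  have "contraction q1 q2 = a * b * (geo q1 * geo q2)"
    by (simp add: contraction_def a_def b_def geo_def)
  moreover have "fps_deriv a = - L 1 * a" "fps_deriv b = - L (q1 * q2) * b"
    unfolding a_def b_def by (rule lin)+
  ultimately have "fps_deriv (contraction q1 q2) = (L q1 + L q2 - L 1 - L (q1 * q2)) * contraction q1 q2"
    by (simp add: geo algebra_simps)
  also have "L q1 + L q2 - L 1 - L (q1 * q2) = Abs_fps (\<lambda>n. - (1 - q1 ^ Suc n) * (1 - q2 ^ Suc n))"
    by (rule fps_ext) (simp add: L_def algebra_simps power_mult_distrib)
  finally show ?thesis .
qed

lemma contraction_0: "fps_nth (contraction q1 q2) 0 = 1"
  by (simp add: contraction_def)

text \<open>The coefficients of \<open>A(x) C(y) = C(y) A(x) g(x y)\<close>, where \<open>A\<close> is regarded as a power series in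
  the inverse \<open>x\<close> of its argument.  For the proof, both sides are power series in \<open>x\<close>
  whose coefficients are power series in \<open>y\<close>.  By \<open>annihilation_op_creation_coeff\<close>, the
  commutator of the exponent of \<open>A\<close> with \<open>C\<close> is \<open>C\<close> times a central series, whose derivative in
  \<open>x\<close> is the logarithmic derivative of \<open>g(x y)\<close>.  So both sides satisfy the linear equation of \<open>A\<close>, and they agree at
  \<open>x = 0\<close>.\<close>

lemma wick_coeff:
  assumes "q2 \<noteq> 0" "\<And>m. m > 0 \<Longrightarrow> q2 ^ m \<noteq> 1"
  shows "annihilation_coeff q1 q2 k * creation_coeff q1 q2 l =
    (\<Sum>i\<le>k. if i \<le> l then scalar_endo (fps_nth (contraction q1 q2) i) *
       (creation_coeff q1 q2 (l - i) * annihilation_coeff q1 q2 (k - i)) else 0)"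
proof -
  define A where "A = Abs_fps (\<lambda>k. fps_const (annihilation_coeff q1 q2 k))"
  define C where "C = Abs_fps (creation_coeff q1 q2)"
  define P where "P = Abs_fps (\<lambda>k. fps_const (fps_nth (fps_deriv (annihilation_exponent q1 q2)) k))"
  define G where "G = Abs_fps (\<lambda>k. monomial (fps_nth (contraction q1 q2) k) k)"
  define \<gamma> where "\<gamma> = (\<lambda>n. - (1 - q1 ^ Suc n) * (1 - q2 ^ Suc n))"
  define \<Gamma> where "\<Gamma> = Abs_fps (\<lambda>k. monomial (\<gamma> k) (Suc k))"
  have fps_const_sum: "fps_const (\<Sum>i\<in>I. f i) = (\<Sum>i\<in>I. fps_const (f i :: endo))" for I :: "nat set" and f
    by (induction I rule: infinite_finite_induct) (simp_all flip: fps_const_add)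
  have dA: "fps_deriv A = P * A"
  proof (rule fps_ext)
    fix n
    have "fps_nth (fps_deriv A) n = fps_const (fps_nth (fps_deriv (Abs_fps (annihilation_coeff q1 q2))) n)"
      unfolding A_def fps_deriv_nth by (simp flip: fps_const_mult fps_of_nat)
    thus "fps_nth (fps_deriv A) n = fps_nth (P * A) n"
      unfolding annihilation_ode A_def P_def fps_mult_nth by (simp add: fps_const_sum)
  qed
  have dG: "fps_deriv G = \<Gamma> * G"
  proof (rule fps_ext)
    fix n
    have "of_nat (Suc n) * fps_nth (contraction q1 q2) (Suc n) =
       fps_nth (Abs_fps \<gamma> * contraction q1 q2) n"
      using contraction_ode[of q1 q2, THEN arg_cong[where f = "\<lambda>f. fps_nth f n"]]
      by (simp add: \<gamma>_def)
    hence "fps_nth (fps_deriv G) n = monomial (fps_nth (Abs_fps \<gamma> * contraction q1 q2) n) (Suc n)"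
      unfolding fps_deriv_nth G_def by (simp add: of_nat_mult_monomial del: of_nat_Suc)
    also have "\<dots> = fps_nth (\<Gamma> * G) n"
      unfolding fps_mult_nth monomial_sum \<Gamma>_def G_def
      by (intro sum.cong refl) (simp add: monomial_mult)
    finally show "fps_nth (fps_deriv G) n = fps_nth (\<Gamma> * G) n" .
  qed
  have PC: "P * fps_const C = fps_const C * P + fps_const C * \<Gamma>"
  proof (rule fps_ext)
    fix n
    let ?m = "Suc n"
    let ?a = "of_nat ?m * (- (1 - q2 powi (- int ?m)) / of_nat ?m)"
    have "fps_nth (fps_deriv (annihilation_exponent q1 q2)) n = scalar_endo (of_nat ?m) *
        (scalar_endo (- (1 - q2 powi (- int ?m)) / of_nat ?m) * heis_op q1 q2 (int ?m))"
      unfolding fps_deriv_nth annihilation_exponent_def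
      by (simp add: scalar_endo_of_nat del: of_nat_Suc minus_diff_eq)
    hence "fps_nth (fps_deriv (annihilation_exponent q1 q2)) n = scalar_endo ?a * heis_op q1 q2 (int ?m)"
      by (simp only: scalar_endo_arith mult.assoc)
    moreover have "fps_const (scalar_endo k * x) = monomial k 0 * fps_const x" for k x
      by (rule fps_ext) (simp add: monomial_def)
    ultimately have P: "fps_nth P n = monomial ?a 0 * fps_const (heis_op q1 q2 (int ?m))"
      by (simp only: P_def fps_nth_Abs_fps)
    \<comment> \<open>The factor \<open>1 - q2\<^sup>-\<^sup>m\<close> of the exponent cancels the denominator of the bracket.\<close>
    have "q2 powi (- int ?m) \<noteq> 1"
      using assms by (simp add: power_int_minus del: power_Suc of_nat_Suc)
    hence \<gamma>: "?a * ((1 - q2 ^ ?m) / of_nat ?m * heis_bracket q1 q2 (int ?m) (- int ?m)) = \<gamma> n"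
      unfolding \<gamma>_def heis_bracket_def
      by (simp add: divide_simps power_int_def del: of_nat_Suc power_Suc)
         (simp add: algebra_simps del: of_nat_Suc power_Suc)
    have "fps_nth (P * fps_const C) n =
        monomial ?a 0 * (fps_const (heis_op q1 q2 (int ?m)) * C)"
      by (simp only: P fps_mult_right_const_nth mult.assoc)
    also have "\<dots> = monomial ?a 0 * (C * fps_const (heis_op q1 q2 (int ?m)))
        + monomial (\<gamma> n) ?m * C"
      unfolding C_def annihilation_op_creation_coeff[OF zero_less_Suc] distrib_left
        mult.assoc[symmetric] monomial_mult \<gamma>[unfolded mult.assoc[symmetric]] add_0_left ..
    also have "\<dots> = fps_nth (fps_const C * P + fps_const C * \<Gamma>) n"
      unfolding fps_add_nth fps_mult_left_const_nth P \<Gamma>_def fps_nth_Abs_fps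
      by (metis monomial_commute mult.assoc)
    finally show "fps_nth (P * fps_const C) n = fps_nth (fps_const C * P + fps_const C * \<Gamma>) n" .
  qed
  have \<Gamma>A: "\<Gamma> * A = A * \<Gamma>"
  proof (rule fps_ext)
    fix n
    show "fps_nth (\<Gamma> * A) n = fps_nth (A * \<Gamma>) n"
      unfolding fps_mult_nth
      by (rule sum.reindex_bij_witness[of _ "\<lambda>i. n - i" "\<lambda>i. n - i"])
         (auto simp: \<Gamma>_def monomial_commute)
  qed
  define H where "H = A * fps_const C - fps_const C * A * G"
  have "fps_deriv H = P * H"
  proof -
    have "fps_deriv H = P * A * fps_const C - (fps_const C * A * (\<Gamma> * G) + fps_const C * (P * A) * G)"
      unfolding H_def fps_deriv_sub fps_deriv_mult dA dG by simp
    also have "\<dots> = P * A * fps_const C - (fps_const C * P + fps_const C * \<Gamma>) * A * G"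
      by (simp only: distrib_right mult.assoc[symmetric]) (simp add: mult.assoc \<Gamma>A[symmetric])
    finally show ?thesis unfolding PC[symmetric] H_def by (simp add: right_diff_distrib mult.assoc)
  qed
  moreover have "fps_nth H 0 = 0"
  proof -
    have "monomial 1 0 = 1" by (rule fps_ext) (simp add: monomial_def)
    thus ?thesis by (simp add: H_def A_def G_def contraction_0)
  qed
  ultimately have "H = 0" by (rule fps_linear_ode_zero[rotated]) (rule endo_fps_torsion_free)
  hence "fps_nth (fps_nth (A * fps_const C) k) l = fps_nth (fps_nth (fps_const C * A * G) k) l"
    by (simp add: H_def)
  moreover have "fps_nth (fps_nth (A * fps_const C) k) l = annihilation_coeff q1 q2 k * creation_coeff q1 q2 l"
    by (simp add: A_def C_def)
  moreover have "fps_nth (fps_nth (fps_const C * A * G) k) l =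
      (\<Sum>i=0..k. if k - i \<le> l then scalar_endo (fps_nth (contraction q1 q2) (k - i)) *
        (creation_coeff q1 q2 (l - (k - i)) * annihilation_coeff q1 q2 i) else 0)"
    unfolding fps_mult_nth[of "fps_const C * A"] fps_sum_nth
    unfolding A_def G_def C_def
    by (intro sum.cong refl) (simp add: mult_monomial_nth fps_mult_right_const_nth)
  moreover have "\<dots> = (\<Sum>i\<le>k. if i \<le> l then scalar_endo (fps_nth (contraction q1 q2) i) *
       (creation_coeff q1 q2 (l - i) * annihilation_coeff q1 q2 (k - i)) else 0)"
    by (rule sum.reindex_bij_witness[of _ "\<lambda>i. k - i" "\<lambda>i. k - i"]) auto
  ultimately show ?thesis by simp
qed

section \<open>The modes of the vertex operator\<close>

lemma total_mode_power:
  fixes B :: "free_alg fps"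
  assumes "\<And>n u. u \<in> Poly_Mapping.keys (fps_nth B n) \<Longrightarrow> total_mode u = int n"
    and "u \<in> Poly_Mapping.keys (fps_nth (B ^ i) n)"
  shows "total_mode u = int n"
  using assms(2)
proof (induction i arbitrary: n u)
  case 0
  thus ?case by (simp split: if_splits)
next
  case (Suc i)
  from Suc.prems have "u \<in> Poly_Mapping.keys (\<Sum>j=0..n. fps_nth B j * fps_nth (B ^ i) (n - j))"
    by (simp add: fps_mult_nth)
  then obtain j where j: "j \<le> n" "u \<in> Poly_Mapping.keys (fps_nth B j * fps_nth (B ^ i) (n - j))"
    using keys_sum by fastforce
  then obtain v w where "u = v + w" "v \<in> Poly_Mapping.keys (fps_nth B j)"
    "w \<in> Poly_Mapping.keys (fps_nth (B ^ i) (n - j))"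
    using keys_mult by blast
  thus ?case using Suc.IH assms(1) j(1) by (simp add: of_nat_diff)
qed

lemma keys_cst_mult: "Poly_Mapping.keys (cst k * x) \<subseteq> Poly_Mapping.keys x"
  using keys_mult[of "cst k" x] by (auto simp: cst_def split: if_splits)

text \<open>The coefficient of \<open>z\<^sup>-\<^sup>n\<close> is homogeneous because each \<open>a\<^sub>n\<close> comes with \<open>z\<^sup>-\<^sup>n\<close> in the exponent.\<close>

lemma total_mode_annihilation:
  assumes "u \<in> Poly_Mapping.keys (fps_nth (vertex_annihilation q2) n)"
  shows "total_mode u = int n"
proof -
  let ?B = "- Abs_fps (\<lambda>n. if n = 0 then 0
     else cst ((1 - q2 powi (- int n)) / of_nat n) * mode_gen (int n))"
  have B: "total_mode u = int n" if "u \<in> Poly_Mapping.keys (fps_nth ?B n)" for u n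
  proof -
    have "n \<noteq> 0" using that by (intro notI) simp
    hence "u \<in> Poly_Mapping.keys (mode_gen (int n))"
      using that keys_cst_mult by fastforce
    thus ?thesis using \<open>n \<noteq> 0\<close> by (simp add: mode_gen_def Abs_mode_inverse)
  qed
  from assms obtain i where "u \<in> Poly_Mapping.keys (cst (1 / fact i) * fps_nth (?B ^ i) n)"
    unfolding vertex_annihilation_def exp_series_def fps_compose_nth
    using keys_sum by fastforce
  hence "u \<in> Poly_Mapping.keys (fps_nth (?B ^ i) n)" using keys_cst_mult by blast
  from total_mode_power[OF B this] show ?thesis .
qed

lemma annihilation_locally_nilpotent:
  "\<exists>N. \<forall>l>N. fps_nth (vertex_annihilation q2) l * x \<in> fock_null q1 q2"
proof -
  define N where "N = (\<Sum>u\<in>Poly_Mapping.keys x. nat \<bar>total_mode u\<bar>)"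
  have "fps_nth (vertex_annihilation q2) l * x \<in> fock_null q1 q2" if l: "l > N" for l
  proof (rule positive_total_mode_null)
    fix u assume "u \<in> Poly_Mapping.keys (fps_nth (vertex_annihilation q2) l * x)"
    then obtain v w where vw: "u = v + w" "v \<in> Poly_Mapping.keys (fps_nth (vertex_annihilation q2) l)"
      "w \<in> Poly_Mapping.keys x"
      using keys_mult by blast
    have "nat \<bar>total_mode w\<bar> \<le> N" unfolding N_def by (rule member_le_sum) (use vw in auto)
    thus "total_mode u > 0" using l vw total_mode_annihilation by fastforce
  qed
  thus ?thesis by blast
qed

text \<open>On such states the sum over all \<open>l\<close> in a mode of the vertex operator may be cut off at \<open>N\<close>.\<close>

definition admissible :: "complex \<Rightarrow> complex \<Rightarrow> state \<Rightarrow> nat \<Rightarrow> bool" where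
  "admissible q1 q2 s N \<longleftrightarrow> (\<forall>l>N. app (annihilation_coeff q1 q2 l) s = (\<lambda>_. 0))"

text \<open>Integer indices, with zero coefficients at the negative ones, allow summation ranges that do not
  depend on the mode index.\<close>

definition creation_int :: "complex \<Rightarrow> complex \<Rightarrow> int \<Rightarrow> endo" where
  "creation_int q1 q2 m = (if m < 0 then 0 else creation_coeff q1 q2 (nat m))"

definition vertex_mode :: "complex \<Rightarrow> complex \<Rightarrow> complex \<Rightarrow> int \<Rightarrow> state \<Rightarrow> state" where
  "vertex_mode q1 q2 c k s e = c * (\<Sum>l | app (annihilation_coeff q1 q2 l) s \<noteq> (\<lambda>_. 0).
     app (creation_int q1 q2 (int l - k)) (app (annihilation_coeff q1 q2 l) s) e)"

lemma vertex_mode_eq: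
  assumes "admissible q1 q2 s N"
  shows "vertex_mode q1 q2 c k s e = c * (\<Sum>l\<le>N.
     app (creation_int q1 q2 (int l - k)) (app (annihilation_coeff q1 q2 l) s) e)"
  unfolding vertex_mode_def
  by (rule arg_cong[where f = "(*) c"], rule sum.mono_neutral_left)
     (use assms in \<open>auto simp: admissible_def not_less[symmetric]\<close>)

lemma admissible_mono: "admissible q1 q2 s N \<Longrightarrow> N \<le> M \<Longrightarrow> admissible q1 q2 s M"
  by (simp add: admissible_def)

lemma admissible_heis_rep: "\<exists>N. admissible q1 q2 (app (heis_rep q1 q2 x) vac_state) N"
proof -
  obtain N where N: "\<forall>l>N. fps_nth (vertex_annihilation q2) l * x \<in> fock_null q1 q2"
    using annihilation_locally_nilpotent by blast
  have "app (annihilation_coeff q1 q2 l) (app (heis_rep q1 q2 x) vac_state) = (\<lambda>_. 0)" if "l > N" for l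
    using heis_rep_null[OF N[rule_format, OF that]]
    by (simp add: annihilation_coeff_def heis_rep_mult)
  thus ?thesis unfolding admissible_def by blast
qed

lemma annihilation_coeff_vac:
  "app (annihilation_coeff q1 q2 l) vac_state = (if l = 0 then vac_state else (\<lambda>_. 0))"
proof (cases "l = 0")
  case False
  have "fps_nth (vertex_annihilation q2) l \<in> fock_null q1 q2"
    by (rule positive_total_mode_null) (use False total_mode_annihilation in fastforce)
  thus ?thesis using False heis_rep_null by (simp add: annihilation_coeff_def)
qed simp

text \<open>The summands dropped in the definition of the modes are null, hence act as zero; after this, and
  with the indices for which the creation coefficient vanishes added, the sum runs over an interval.\<close>

lemma rho_e_fock_class:
  "\<exists>y. rho_e q1 q2 c k (fock_class q1 q2 x) = fock_class q1 q2 y \<and>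
     app (heis_rep q1 q2 y) vac_state =
       vertex_mode q1 q2 c k (app (heis_rep q1 q2 x) vac_state)"
proof -
  define L where "L = (\<lambda>x. {l. int l \<ge> k \<and> fps_nth (vertex_annihilation q2) l * x \<notin> fock_null q1 q2})"
  define f where "f = (\<lambda>x. cst c * (\<Sum>l\<in>L x.
    fps_nth (vertex_creation q2) (nat (int l - k)) * fps_nth (vertex_annihilation q2) l * x))"
  have "f y - f x \<in> fock_null q1 q2" if "y - x \<in> fock_null q1 q2" for y
  proof -
    have "a * y \<in> fock_null q1 q2 \<longleftrightarrow> a * x \<in> fock_null q1 q2" for a
      using fock_null_lmult[OF that, of a] fock_null.add[of "a * y - a * x" q1 q2 "a * x"]
        fock_null_diff[of "a * y" q1 q2 "a * y - a * x"] by (auto simp: right_diff_distrib)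
    hence "L y = L x" by (simp add: L_def)
    hence "f y - f x = cst c * (\<Sum>l\<in>L x.
      fps_nth (vertex_creation q2) (nat (int l - k)) * fps_nth (vertex_annihilation q2) l * (y - x))"
      by (simp add: f_def right_diff_distrib sum_subtractf)
    thus ?thesis using that by (auto intro!: fock_null_lmult fock_null_sum)
  qed
  hence "(\<Union>y\<in>fock_class q1 q2 x. fock_class q1 q2 (f y)) = fock_class q1 q2 (f x)"
    by (rule union_fock_class)
  hence "rho_e q1 q2 c k (fock_class q1 q2 x) = fock_class q1 q2 (f x)"
    by (simp add: rho_e_def L_def f_def)
  moreover have "app (heis_rep q1 q2 (f x)) vac_state =
      vertex_mode q1 q2 c k (app (heis_rep q1 q2 x) vac_state)" (is "_ = vertex_mode _ _ _ _ ?s")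
  proof
    fix e
    obtain N where N: "\<forall>l>N. fps_nth (vertex_annihilation q2) l * x \<in> fock_null q1 q2"
      using annihilation_locally_nilpotent by blast
    have zero: "app (annihilation_coeff q1 q2 l) ?s = (\<lambda>_. 0)"
      if "fps_nth (vertex_annihilation q2) l * x \<in> fock_null q1 q2" for l
      using heis_rep_null[OF that] by (simp add: annihilation_coeff_def heis_rep_mult)
    have "app (heis_rep q1 q2 (f x)) vac_state e = c * (\<Sum>l\<in>L x.
       app (creation_coeff q1 q2 (nat (int l - k))) (app (annihilation_coeff q1 q2 l) ?s) e)"
      by (simp add: f_def heis_rep_mult heis_rep_sum app_sum_left creation_coeff_def annihilation_coeff_def)
    also have "\<dots> = c * (\<Sum>l\<in>L x.
       app (creation_int q1 q2 (int l - k)) (app (annihilation_coeff q1 q2 l) ?s) e)"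
      by (simp add: L_def creation_int_def)
    also have "\<dots> = c * (\<Sum>l\<le>N.
       app (creation_int q1 q2 (int l - k)) (app (annihilation_coeff q1 q2 l) ?s) e)"
    proof (rule arg_cong[where f = "(*) c"], rule sum.mono_neutral_left)
      show "L x \<subseteq> {..N}" using N by (auto simp: L_def not_less[symmetric])
      show "\<forall>l\<in>{..N} - L x. app (creation_int q1 q2 (int l - k)) (app (annihilation_coeff q1 q2 l) ?s) e = 0"
        using zero by (auto simp: L_def creation_int_def)
    qed simp
    also have "\<dots> = vertex_mode q1 q2 c k ?s e"
      by (rule vertex_mode_eq[symmetric]) (use N zero in \<open>auto simp: admissible_def\<close>)
    finally show "app (heis_rep q1 q2 (f x)) vac_state e = vertex_mode q1 q2 c k ?s e" .
  qed
  ultimately show ?thesis by blast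
qed

definition vertex_state :: "complex \<Rightarrow> complex \<Rightarrow> complex \<Rightarrow> int list \<Rightarrow> state" where
  "vertex_state q1 q2 c ks = foldr (vertex_mode q1 q2 c) ks vac_state"

lemma vertex_state_rho_e:
  "\<exists>x. foldr (rho_e q1 q2 c) ks (vac q1 q2) = fock_class q1 q2 x \<and>
       app (heis_rep q1 q2 x) vac_state = vertex_state q1 q2 c ks"
proof (induction ks)
  case Nil
  show ?case by (rule exI[of _ 1]) (simp add: vac_def vertex_state_def)
next
  case (Cons k ks)
  then obtain x where x: "foldr (rho_e q1 q2 c) ks (vac q1 q2) = fock_class q1 q2 x"
    "app (heis_rep q1 q2 x) vac_state = vertex_state q1 q2 c ks" by blast
  from rho_e_fock_class[of q1 q2 c k x] show ?case using x by (simp add: vertex_state_def)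
qed

lemma vac_dual_rho_e:
  "vac_dual q1 q2 (foldr (rho_e q1 q2 c) ks (vac q1 q2)) = vertex_state q1 q2 c ks (\<lambda>_. 0)"
  using vertex_state_rho_e[of q1 q2 c ks]
  by (auto simp: vac_dual_fock_class vacuum_expectation_def)

lemma admissible_vertex_state: "\<exists>N. admissible q1 q2 (vertex_state q1 q2 c ks) N"
  using vertex_state_rho_e[of q1 q2 c ks] admissible_heis_rep by metis

lemma vertex_mode_sum:
  assumes "finite I" "\<And>i. i \<in> I \<Longrightarrow> \<exists>N. admissible q1 q2 (s i) N"
  shows "vertex_mode q1 q2 c k (\<lambda>e. \<Sum>i\<in>I. a i * s i e) e = (\<Sum>i\<in>I. a i * vertex_mode q1 q2 c k (s i) e)"
proof -
  obtain N where N: "\<And>i. i \<in> I \<Longrightarrow> admissible q1 q2 (s i) (N i)" using assms(2) by metis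
  define M where "M = (\<Sum>i\<in>I. N i)"
  have M: "admissible q1 q2 (s i) M" if "i \<in> I" for i
    using N[OF that] member_le_sum[of i I N] assms(1) that by (auto simp: M_def intro: admissible_mono)
  have "admissible q1 q2 (\<lambda>e. \<Sum>i\<in>I. a i * s i e) M"
    using M by (simp add: admissible_def app_sum)
  hence "vertex_mode q1 q2 c k (\<lambda>e. \<Sum>i\<in>I. a i * s i e) e =
      (\<Sum>l\<le>M. \<Sum>i\<in>I. a i * (c * app (creation_int q1 q2 (int l - k)) (app (annihilation_coeff q1 q2 l) (s i)) e))"
    by (simp add: vertex_mode_eq app_sum sum_distrib_left mult.left_commute)
  also have "\<dots> = (\<Sum>i\<in>I. a i * vertex_mode q1 q2 c k (s i) e)"
    by (subst sum.swap) (intro sum.cong refl, simp add: vertex_mode_eq[OF M] sum_distrib_left)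
  finally show ?thesis .
qed

lemma wick_int:
  assumes "q2 \<noteq> 0" "\<And>m. m > 0 \<Longrightarrow> q2 ^ m \<noteq> 1"
  shows "app (annihilation_coeff q1 q2 j) (app (creation_int q1 q2 m) s) e =
    (\<Sum>i\<le>j. fps_nth (contraction q1 q2) i *
       app (creation_int q1 q2 (m - int i)) (app (annihilation_coeff q1 q2 (j - i)) s) e)"
proof (cases "m < 0")
  case False
  have "app (annihilation_coeff q1 q2 j) (app (creation_int q1 q2 m) s) e =
        app (annihilation_coeff q1 q2 j * creation_coeff q1 q2 (nat m)) s e"
    using False by (simp add: creation_int_def)
  also have "\<dots> = (\<Sum>i\<le>j. if i \<le> nat m then fps_nth (contraction q1 q2) i *
       app (creation_coeff q1 q2 (nat m - i)) (app (annihilation_coeff q1 q2 (j - i)) s) e else 0)"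
    by (subst wick_coeff[OF assms], assumption, unfold app_sum_left) (intro sum.cong refl, simp)
  also have "\<dots> = (\<Sum>i\<le>j. fps_nth (contraction q1 q2) i *
       app (creation_int q1 q2 (m - int i)) (app (annihilation_coeff q1 q2 (j - i)) s) e)"
    using False by (intro sum.cong refl) (auto simp: creation_int_def nat_diff_distrib')
  finally show ?thesis .
qed (simp add: creation_int_def)

text \<open>The exchange relation \<open>A(x) e(y) = g(y/x) e(y) A(x)\<close> in terms of modes.\<close>

lemma annihilation_vertex_mode:
  assumes "q2 \<noteq> 0" "\<And>m. m > 0 \<Longrightarrow> q2 ^ m \<noteq> 1" and "admissible q1 q2 s N"
  shows "app (annihilation_coeff q1 q2 j) (vertex_mode q1 q2 c k s) e =
    (\<Sum>i\<le>j. fps_nth (contraction q1 q2) i *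
       vertex_mode q1 q2 c (k + int i) (app (annihilation_coeff q1 q2 (j - i)) s) e)"
proof -
  let ?A = "annihilation_coeff q1 q2" and ?C = "creation_int q1 q2" and ?g = "fps_nth (contraction q1 q2)"
  have comm: "app (?A i) (app (?A l) s) = app (?A l) (app (?A i) s)" for i l
    using annihilation_coeff_commute[of q1 q2 i l] by (metis app_simps(1))
  have adm: "admissible q1 q2 (app (?A i) s) N" for i
    using assms(3) by (simp add: admissible_def comm[of _ i])
  have "vertex_mode q1 q2 c k s = (\<lambda>e. \<Sum>l\<le>N. c * app (?C (int l - k)) (app (?A l) s) e)"
    by (rule ext) (simp add: vertex_mode_eq[OF assms(3)] sum_distrib_left)
  hence "app (?A j) (vertex_mode q1 q2 c k s) e =
     (\<Sum>l\<le>N. c * (\<Sum>i\<le>j. ?g i * app (?C (int l - k - int i)) (app (?A (j - i)) (app (?A l) s)) e))"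
    by (simp add: app_sum wick_int[OF assms(1,2)])
  also have "\<dots> = (\<Sum>i\<le>j. \<Sum>l\<le>N. c * (?g i * app (?C (int l - k - int i)) (app (?A (j - i)) (app (?A l) s)) e))"
    unfolding sum_distrib_left by (rule sum.swap)
  also have "\<dots> = (\<Sum>i\<le>j. ?g i * vertex_mode q1 q2 c (k + int i) (app (?A (j - i)) s) e)"
    by (simp add: vertex_mode_eq[OF adm] sum_distrib_left comm mult.left_commute diff_diff_eq)
  finally show ?thesis .
qed

subsection \<open>A recursion for the correlators\<close>

text \<open>Compositions of \<open>j\<close> into \<open>m\<close> parts, which may be zero.\<close>

definition compositions :: "nat \<Rightarrow> nat \<Rightarrow> nat list set" where
  "compositions m j = {is. length is = m \<and> sum_list is = j}"

lemma compositions_0: "compositions 0 j = (if j = 0 then {[]} else {})"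
  by (auto simp: compositions_def)

lemma compositions_Suc: "compositions (Suc m) j = (\<Union>i\<le>j. (#) i ` compositions m (j - i))"
proof (intro subset_antisym subsetI)
  fix x assume "x \<in> compositions (Suc m) j"
  thus "x \<in> (\<Union>i\<le>j. (#) i ` compositions m (j - i))"
    by (cases x) (auto simp: compositions_def intro!: bexI[of _ "hd x"])
qed (auto simp: compositions_def)

lemma finite_compositions: "finite (compositions m j)"
  by (induction m arbitrary: j) (simp_all add: compositions_0 compositions_Suc)

lemma sum_compositions_Suc:
  "(\<Sum>is\<in>compositions (Suc m) j. F is) = (\<Sum>i\<le>j. \<Sum>is\<in>compositions m (j - i). F (i # is))"
  unfolding compositions_Suc
  by (subst sum.UNION_disjoint) (auto simp: finite_compositions sum.reindex)

text \<open>Moving \<open>A(x)\<close> past several vertex operators onto the vacuum: each passage shifts the mode of the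
  vertex operator by the power of \<open>y/x\<close> taken from the contraction, and what is left of
  \<open>A(x)\<close> on the vacuum is its constant term.\<close>

lemma annihilation_vertex_state:
  assumes "q2 \<noteq> 0" "\<And>m. m > 0 \<Longrightarrow> q2 ^ m \<noteq> 1"
  shows "app (annihilation_coeff q1 q2 j) (vertex_state q1 q2 c ks) e =
    (\<Sum>is\<in>compositions (length ks) j. (\<Prod>i\<leftarrow>is. fps_nth (contraction q1 q2) i) *
       vertex_state q1 q2 c (map2 (\<lambda>k i. k + int i) ks is) e)"
proof (induction ks arbitrary: j e)
  case Nil
  show ?case by (simp add: vertex_state_def annihilation_coeff_vac compositions_0)
next
  case (Cons k ks)
  let ?g = "fps_nth (contraction q1 q2)" and ?A = "annihilation_coeff q1 q2"
  let ?sh = "map2 (\<lambda>k i. k + int i)"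
  obtain N where N: "admissible q1 q2 (vertex_state q1 q2 c ks) N"
    using admissible_vertex_state by blast
  have "app (?A j) (vertex_state q1 q2 c (k # ks)) e =
    (\<Sum>i\<le>j. ?g i * vertex_mode q1 q2 c (k + int i) (app (?A (j - i)) (vertex_state q1 q2 c ks)) e)"
    using annihilation_vertex_mode[OF assms N] by (simp add: vertex_state_def)
  also have "\<dots> = (\<Sum>i\<le>j. ?g i * (\<Sum>is\<in>compositions (length ks) (j - i). (\<Prod>i\<leftarrow>is. ?g i) *
       vertex_mode q1 q2 c (k + int i) (vertex_state q1 q2 c (?sh ks is)) e))"
  proof (intro sum.cong refl arg_cong[where f = "(*) _"])
    fix i
    have "app (?A (j - i)) (vertex_state q1 q2 c ks) = (\<lambda>e. \<Sum>is\<in>compositions (length ks) (j - i).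
       (\<Prod>i\<leftarrow>is. ?g i) * vertex_state q1 q2 c (?sh ks is) e)"
      by (rule ext) (rule Cons)
    thus "vertex_mode q1 q2 c (k + int i) (app (?A (j - i)) (vertex_state q1 q2 c ks)) e =
      (\<Sum>is\<in>compositions (length ks) (j - i). (\<Prod>i\<leftarrow>is. ?g i) *
       vertex_mode q1 q2 c (k + int i) (vertex_state q1 q2 c (?sh ks is)) e)"
      by (simp add: vertex_mode_sum finite_compositions admissible_vertex_state)
  qed
  also have "\<dots> = (\<Sum>is\<in>compositions (length (k # ks)) j. (\<Prod>i\<leftarrow>is. ?g i) *
       vertex_state q1 q2 c (?sh (k # ks) is) e)"
    by (simp add: sum_compositions_Suc sum_distrib_left mult.assoc vertex_state_def)
  finally show ?case .
qed

text \<open>The dual of the vacuum kills the image of every creation operator, and by the differential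
  equation every coefficient of \<open>C\<close> except the constant one is a sum of such images.\<close>

lemma creation_int_at_0: "app (creation_int q1 q2 m) s (\<lambda>_. 0) = (if m = 0 then s (\<lambda>_. 0) else 0)"
proof (cases "m > 0")
  case True
  then obtain n where m: "m = int (Suc n)" by (metis zero_less_imp_eq_int Suc_pred of_nat_0_less_iff)
  let ?P = "fps_deriv (creation_exponent q1 q2)"
  have P: "app (fps_nth ?P i) t (\<lambda>_. 0) = 0" for i t
  proof -
    have "fps_nth ?P i = scalar_endo (of_nat (Suc i)) * fps_nth (creation_exponent q1 q2) (Suc i)"
      by (simp add: scalar_endo_of_nat del: of_nat_Suc)
    thus ?thesis by (simp add: creation_exponent_def heis_op_creation_at_0)
  qed
  have "scalar_endo (of_nat (Suc n)) * creation_coeff q1 q2 (Suc n) =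
      (\<Sum>i=0..n. fps_nth ?P i * creation_coeff q1 q2 (n - i))"
    using creation_ode[of q1 q2, THEN arg_cong[where f = "\<lambda>f. fps_nth f n"]]
    unfolding fps_mult_nth by (simp add: scalar_endo_of_nat del: of_nat_Suc fps_deriv_nth) (simp del: of_nat_Suc)
  from this[THEN arg_cong[where f = "\<lambda>x. app x s (\<lambda>_. 0)"]]
  have "of_nat (Suc n) * app (creation_coeff q1 q2 (Suc n)) s (\<lambda>_. 0) = 0"
    by (simp add: app_sum_left P del: of_nat_Suc fps_deriv_nth)
  hence "app (creation_coeff q1 q2 (Suc n)) s (\<lambda>_. 0) = 0"
    by (simp del: of_nat_Suc)
  thus ?thesis by (simp add: m creation_int_def nat_add_distrib)
qed (simp add: creation_int_def)

definition correlator :: "complex \<Rightarrow> complex \<Rightarrow> complex \<Rightarrow> int list \<Rightarrow> complex" where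
  "correlator q1 q2 c ks = vertex_state q1 q2 c ks (\<lambda>_. 0)"

lemma correlator_Nil: "correlator q1 q2 c [] = 1"
  by (simp add: correlator_def vertex_state_def vac_state_def)

text \<open>The creation part of the leftmost operator acts as \<open>1\<close> on the dual of the vacuum, so that the
  annihilation coefficient of the same index remains.\<close>

lemma correlator_Cons:
  assumes "q2 \<noteq> 0" "\<And>m. m > 0 \<Longrightarrow> q2 ^ m \<noteq> 1"
  shows "correlator q1 q2 c (k # ks) = (if k < 0 then 0 else
    c * (\<Sum>is\<in>compositions (length ks) (nat k). (\<Prod>i\<leftarrow>is. fps_nth (contraction q1 q2) i) *
       correlator q1 q2 c (map2 (\<lambda>k i. k + int i) ks is)))"
proof -
  obtain N where N: "admissible q1 q2 (vertex_state q1 q2 c ks) N"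
    using admissible_vertex_state by blast
  let ?M = "max N (nat k)"
  have "correlator q1 q2 c (k # ks) = vertex_mode q1 q2 c k (vertex_state q1 q2 c ks) (\<lambda>_. 0)"
    by (simp add: correlator_def vertex_state_def)
  also have "\<dots> = c * (\<Sum>l\<le>?M. if int l = k then
       app (annihilation_coeff q1 q2 l) (vertex_state q1 q2 c ks) (\<lambda>_. 0) else 0)"
    using N by (subst vertex_mode_eq[of _ _ _ ?M]) (auto simp: creation_int_at_0 intro: admissible_mono)
  also have "\<dots> = (if k < 0 then 0 else
       c * app (annihilation_coeff q1 q2 (nat k)) (vertex_state q1 q2 c ks) (\<lambda>_. 0))"
  proof (cases "k < 0")
    case False
    hence "int l = k \<longleftrightarrow> l = nat k" for l by auto
    thus ?thesis using False by simp
  qed (simp add: sum.neutral)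
  finally show ?thesis by (simp add: annihilation_vertex_state[OF assms] correlator_def)
qed

section \<open>Convergence of the correlators\<close>

lemma has_sum_times:
  fixes f :: "'a \<Rightarrow> complex" and g :: "'b \<Rightarrow> complex"
  assumes f: "(f has_sum a) A" and g: "(g has_sum b) B"
  shows "((\<lambda>(x, y). f x * g y) has_sum (a * b)) (A \<times> B)"
proof (rule has_sum_SigmaI)
  show "((\<lambda>y. case (x, y) of (x, y) \<Rightarrow> f x * g y) has_sum (f x * b)) B" for x
    using has_sum_cmult_right[OF g] by simp
  show "((\<lambda>x. f x * b) has_sum (a * b)) A"
    using has_sum_cmult_left[OF f] by simp
  have fs: "(\<lambda>x. norm (f x)) summable_on A" and gs: "(\<lambda>y. norm (g y)) summable_on B"
    using f g summable_on_iff_abs_summable_on_complex by (auto dest: has_sum_imp_summable)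
  have "(\<lambda>p. norm (case p of (x, y) \<Rightarrow> f x * g y)) summable_on A \<times> B"
    unfolding Infinite_Sum.abs_summable_on_Sigma_iff
  proof (intro conjI ballI)
    show "(\<lambda>y. norm (case (x, y) of (x, y) \<Rightarrow> f x * g y)) summable_on B" for x
      using summable_on_cmult_right[OF gs] by (simp add: norm_mult)
    show "(\<lambda>x. norm (\<Sum>\<^sub>\<infinity>y\<in>B. norm (case (x, y) of (x, y) \<Rightarrow> f x * g y))) summable_on A"
      using summable_on_cmult_left[OF fs, of "\<bar>\<Sum>\<^sub>\<infinity>y\<in>B. norm (g y)\<bar>"]
      by (simp add: norm_mult infsum_cmult_right' abs_mult)
  qed
  thus "(\<lambda>(x, y). f x * g y) summable_on A \<times> B" by (rule abs_summable_summable)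
qed

text \<open>A product of series is a series over tuples, here represented by lists of fixed length.\<close>

lemma has_sum_prod_lists:
  fixes h :: "nat \<Rightarrow> nat \<Rightarrow> complex"
  assumes "\<And>j. j < n \<Longrightarrow> (h j has_sum S j) UNIV"
  shows "((\<lambda>is. \<Prod>j<n. h j (is ! j)) has_sum (\<Prod>j<n. S j)) {is. length is = n}"
  using assms
proof (induction n arbitrary: h S)
  case 0
  have "{is::nat list. is = []} = {[]}" by auto
  thus ?case by (simp add: has_sum_finite_iff)
next
  case (Suc n)
  have "((\<lambda>is. \<Prod>j<n. h (Suc j) (is ! j)) has_sum (\<Prod>j<n. S (Suc j))) {is. length is = n}"
    by (rule Suc.IH) (use Suc.prems in auto)
  from has_sum_times[OF Suc.prems[of 0] this]
  have "((\<lambda>(i, is). h 0 i * (\<Prod>j<n. h (Suc j) (is ! j))) has_sum (S 0 * (\<Prod>j<n. S (Suc j))))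
     (UNIV \<times> {is. length is = n})" by simp
  also have "?this \<longleftrightarrow> ((\<lambda>is. h 0 (hd is) * (\<Prod>j<n. h (Suc j) (tl is ! j)))
     has_sum (S 0 * (\<Prod>j<n. S (Suc j)))) {is. length is = Suc n}"
    by (rule has_sum_reindex_bij_witness[of _ "\<lambda>is. (hd is, tl is)" "\<lambda>(i, is). i # is"])
       (auto simp: length_Suc_conv)
  also have "\<dots> \<longleftrightarrow> ((\<lambda>is. \<Prod>j<Suc n. h j (is ! j)) has_sum (\<Prod>j<Suc n. S j)) {is. length is = Suc n}"
    unfolding prod.lessThan_Suc_shift
    by (rule has_sum_cong) (auto simp: length_Suc_conv)
  finally show ?case .
qed

lemma has_sum_fps_mult:
  fixes f g :: "complex fps"
  assumes "((\<lambda>n. fps_nth f n * t ^ n) has_sum a) UNIV" "((\<lambda>n. fps_nth g n * t ^ n) has_sum b) UNIV"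
  shows "((\<lambda>n. fps_nth (f * g) n * t ^ n) has_sum (a * b)) UNIV"
proof -
  have "((\<lambda>(i, j). fps_nth f i * t ^ i * (fps_nth g j * t ^ j)) has_sum (a * b)) (UNIV \<times> UNIV)"
    by (rule has_sum_times) (fact assms)+
  also have "?this \<longleftrightarrow> ((\<lambda>(n, i). fps_nth f i * fps_nth g (n - i) * t ^ n) has_sum (a * b))
      (SIGMA n:UNIV. {0..n})"
    by (rule has_sum_reindex_bij_witness[of _ "\<lambda>(n, i). (i, n - i)" "\<lambda>(i, j). (i + j, i)"])
       (auto simp: power_add)
  finally show ?thesis
    by (rule has_sum_SigmaD) (auto intro!: has_sum_finiteI simp: fps_mult_nth sum_distrib_right)
qed

lemma has_sum_contraction:
  assumes "norm (q1 * t) < 1" "norm (q2 * t) < 1"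
  shows "((\<lambda>n. fps_nth (contraction q1 q2) n * t ^ n) has_sum
    ((1 - t) * (1 - q1 * q2 * t) / ((1 - q1 * t) * (1 - q2 * t)))) UNIV"
proof -
  have geo: "((\<lambda>n. fps_nth (Abs_fps (\<lambda>n. q ^ n)) n * t ^ n) has_sum (1 / (1 - q * t))) UNIV"
    if "norm (q * t) < 1" for q :: complex
    using norm_summable_imp_has_sum[of "\<lambda>n. (q * t) ^ n" "1 / (1 - q * t)"] that
    by (simp add: geometric_sums norm_power power_mult_distrib flip: norm_mult)
       (simp add: geometric_sums norm_power power_mult_distrib norm_mult summable_geometric flip: norm_mult power_mult_distrib)
  have lin: "((\<lambda>n. fps_nth (1 - fps_const q * fps_X) n * t ^ n) has_sum (1 - q * t)) UNIV" for q :: complex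
  proof -
    have "((\<lambda>n. fps_nth (1 - fps_const q * fps_X) n * t ^ n) has_sum (1 - q * t)) {0, 1}"
      by (rule has_sum_finiteI) simp_all
    thus ?thesis
      by (rule has_sum_cong_neutral[THEN iffD1, rotated -1]) (auto simp: fps_X_def)
  qed
  have "contraction q1 q2 = (1 - fps_const 1 * fps_X) * (1 - fps_const (q1 * q2) * fps_X) *
     (Abs_fps (\<lambda>n. q1 ^ n) * Abs_fps (\<lambda>n. q2 ^ n))" by (simp add: contraction_def)
  thus ?thesis
    using has_sum_fps_mult[OF has_sum_fps_mult[OF lin[of 1] lin[of "q1 * q2"]]
      has_sum_fps_mult[OF geo[OF assms(1)] geo[OF assms(2)]]] by simp
qed

text \<open>Induction on the number of operators.  The claimed value for \<open>n + 1\<close> variables is \<open>c\<close> times the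
  value for the variables \<open>z\<^sub>1, \<dots>, z\<^sub>n\<close> times the product of the \<open>g(z\<^sub>j/z\<^sub>0)\<close>.  Both factors are
  absolutely convergent, so their product is a series over pairs of a tuple of modes and a tuple of
  exponents of contractions.  Collecting the pairs with the same total power of every
  variable gives the recursion \<open>correlator_Cons\<close>.\<close>

theorem has_sum_correlator:
  assumes q2: "q2 \<noteq> 0" "\<And>m. m > 0 \<Longrightarrow> q2 ^ m \<noteq> 1"
    and "\<And>i. i < n \<Longrightarrow> z i \<noteq> 0"
    and "\<And>i j. i < j \<Longrightarrow> j < n \<Longrightarrow> norm (q1 * (z j / z i)) < 1 \<and> norm (q2 * (z j / z i)) < 1"
  shows "((\<lambda>ks. correlator q1 q2 c ks * (\<Prod>j<n. z j powi (- (ks ! j)))) has_sum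
    (c ^ n * (\<Prod>j<n. \<Prod>i<j. (1 - z j / z i) * (1 - q1 * q2 * (z j / z i)) /
       ((1 - q1 * (z j / z i)) * (1 - q2 * (z j / z i)))))) {ks. length ks = n}"
  using assms(3,4)
proof (induction n arbitrary: z)
  case 0
  have "{ks::int list. ks = []} = {[]}" by auto
  thus ?case by (simp add: has_sum_finite_iff correlator_Nil)
next
  case (Suc n)
  define \<phi> where "\<phi> = (\<lambda>t. (1 - t) * (1 - q1 * q2 * t) / ((1 - q1 * t) * (1 - q2 * t)))"
  define y where "y = (\<lambda>j. z (Suc j))"
  define g where "g = fps_nth (contraction q1 q2)"
  define sh where "sh = map2 (\<lambda>k i. k + int i)"
  define Y where "Y = (\<lambda>ks. \<Prod>j<n. y j powi (- (ks ! j)))"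
  define W where "W = (\<Prod>j<n. \<phi> (y j / z 0))"
  define V where "V = c ^ n * (\<Prod>j<n. \<Prod>i<j. \<phi> (y j / y i))"
  have y0: "y j \<noteq> 0" if "j < n" for j using Suc.prems(1) that by (simp add: y_def)
  have "((\<lambda>ks. correlator q1 q2 c ks * Y ks) has_sum V) {ks. length ks = n}"
    unfolding V_def Y_def \<phi>_def y_def by (rule Suc.IH) (use Suc.prems in auto)
  moreover have "((\<lambda>is. \<Prod>j<n. g (is ! j) * (y j / z 0) ^ (is ! j)) has_sum W) {is. length is = n}"
    unfolding W_def g_def \<phi>_def y_def
    by (rule has_sum_prod_lists, rule has_sum_contraction) (use Suc.prems in auto)
  ultimately have "((\<lambda>(ks, is). correlator q1 q2 c ks * Y ks * (\<Prod>j<n. g (is ! j) * (y j / z 0) ^ (is ! j)))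
      has_sum (V * W)) ({ks. length ks = n} \<times> {is. length is = n})"
    by (rule has_sum_times)
  \<comment> \<open>The shift by \<open>is\<close> absorbs the factor \<open>y\<^sub>j\<close> of each \<open>y\<^sub>j/z\<^sub>0\<close>; the powers of \<open>z\<^sub>0\<close> that are left
    have the exponent \<open>- sum_list is\<close>, the negative of the new first mode.\<close>
  also have "?this \<longleftrightarrow> ((\<lambda>((ks, j), is). (\<Prod>i\<leftarrow>is. g i) * correlator q1 q2 c (sh ks is) * (Y ks * z 0 powi (- int j)))
      has_sum (V * W)) (SIGMA (ks, j):{ks. length ks = n} \<times> UNIV. compositions n j)"
  proof (rule has_sum_reindex_bij_witness[of _ "\<lambda>((ks, j), is). (sh ks is, is)"
        "\<lambda>(ks, is). ((map2 (\<lambda>k i. k - int i) ks is, sum_list is), is)"])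
    fix a :: "int list \<times> nat list"
    assume "a \<in> {ks. length ks = n} \<times> {is. length is = n}"
    then obtain ks :: "int list" and "is" :: "nat list" where a: "a = (ks, is)" "length ks = n" "length is = n" by auto
    let ?ks = "map2 (\<lambda>k i. k - int i) ks is"
    have "sh ?ks is = ks" using a by (auto simp: sh_def intro!: nth_equalityI)
    thus "(\<lambda>((ks, j), is). (sh ks is, is)) ((\<lambda>(ks, is). ((map2 (\<lambda>k i. k - int i) ks is, sum_list is), is)) a) = a"
      by (simp add: a)
    show "(\<lambda>(ks, is). ((map2 (\<lambda>k i. k - int i) ks is, sum_list is), is)) a
       \<in> (SIGMA (ks, j):{ks. length ks = n} \<times> UNIV. compositions n j)"
      using a by (simp add: compositions_def)
    have Y: "Y ks * (\<Prod>j<n. (y j / z 0) ^ (is ! j)) = Y ?ks * z 0 powi (- int (sum_list is))"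
    proof -
      have "Y ks * (\<Prod>j<n. (y j / z 0) ^ (is ! j)) =
         (\<Prod>j<n. y j powi (- (?ks ! j)) * z 0 powi (- int (is ! j)))"
        unfolding Y_def prod.distrib[symmetric]
      proof (rule prod.cong[OF refl])
        fix j assume "j \<in> {..<n}"
        hence j: "j < n" by simp
        have "y j powi (- (?ks ! j)) = y j powi (- (ks ! j)) * y j ^ (is ! j)"
          using y0[OF j] a j by (simp add: power_int_add[symmetric] flip: power_int_of_nat)
        thus "y j powi (- (ks ! j)) * (y j / z 0) ^ (is ! j) =
           y j powi (- (?ks ! j)) * z 0 powi (- int (is ! j))"
          by (simp add: power_divide power_int_minus divide_inverse power_mult_distrib power_inverse)
      qed
      also have "\<dots> = Y ?ks * (\<Prod>j<n. z 0 powi (- int (is ! j)))"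
        unfolding Y_def by (rule prod.distrib)
      also have "(\<Prod>j<n. z 0 powi (- int (is ! j))) = z 0 powi (- int (sum_list is))"
      proof -
        have "(\<Prod>j<n. z 0 powi (- int (is ! j))) = inverse (\<Prod>j<n. z 0 ^ (is ! j))"
          by (simp add: power_int_minus prod_inversef[symmetric] o_def)
        also have "(\<Prod>j<n. z 0 ^ (is ! j)) = z 0 ^ sum_list is"
          using a by (simp add: sum_list_sum_nth power_sum atLeast0LessThan)
        finally show ?thesis by (simp add: power_int_minus)
      qed
      finally show ?thesis .
    qed
    have "(\<Prod>i\<leftarrow>is. g i) = (\<Prod>j<n. g (is ! j))"
      using a by (simp add: prod.list_conv_set_nth atLeast0LessThan)
    thus "(\<lambda>((ks, j), is). (\<Prod>i\<leftarrow>is. g i) * correlator q1 q2 c (sh ks is) * (Y ks * z 0 powi (- int j)))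
       ((\<lambda>(ks, is). ((map2 (\<lambda>k i. k - int i) ks is, sum_list is), is)) a) =
      (\<lambda>(ks, is). correlator q1 q2 c ks * Y ks * (\<Prod>j<n. g (is ! j) * (y j / z 0) ^ (is ! j))) a"
      using Y \<open>sh ?ks is = ks\<close> by (simp add: a(1) prod.distrib mult_ac)
  next
    fix b :: "(int list \<times> nat) \<times> nat list"
    assume "b \<in> (SIGMA (ks, j):{ks. length ks = n} \<times> UNIV. compositions n j)"
    then obtain ks j "is" where b: "b = ((ks, j), is)" "length ks = n" "length is = n" "sum_list is = j"
      by (auto simp: compositions_def)
    have "map2 (\<lambda>k i. k - int i) (sh ks is) is = ks"
      using b by (auto simp: sh_def intro!: nth_equalityI)
    thus "(\<lambda>(ks, is). ((map2 (\<lambda>k i. k - int i) ks is, sum_list is), is)) ((\<lambda>((ks, j), is). (sh ks is, is)) b) = b"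
      using b by simp
    show "(\<lambda>((ks, j), is). (sh ks is, is)) b \<in> {ks. length ks = n} \<times> {is. length is = n}"
      using b by (simp add: sh_def)
  qed (rule refl)
  finally have "((\<lambda>(ks, j). \<Sum>is\<in>compositions n j. (\<Prod>i\<leftarrow>is. g i) * correlator q1 q2 c (sh ks is) *
       (Y ks * z 0 powi (- int j))) has_sum (V * W)) ({ks. length ks = n} \<times> UNIV)"
    by (rule has_sum_SigmaD) (auto intro!: has_sum_finiteI finite_compositions)
  from has_sum_cmult_right[OF this, of c]
  have "((\<lambda>(ks, j). correlator q1 q2 c (int j # ks) * (Y ks * z 0 powi (- int j))) has_sum (c * (V * W)))
      ({ks. length ks = n} \<times> UNIV)"
    by (rule has_sum_cong[THEN iffD1, rotated])
       (auto simp: correlator_Cons[OF q2] g_def sh_def sum_distrib_left sum_distrib_right mult.assoc)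
  also have "?this \<longleftrightarrow> ((\<lambda>ks. correlator q1 q2 c ks * (\<Prod>j<Suc n. z j powi (- (ks ! j)))) has_sum (c * (V * W)))
      {ks. length ks = Suc n \<and> hd ks \<ge> 0}"
    by (rule has_sum_reindex_bij_witness[of _ "\<lambda>ks. (tl ks, nat (hd ks))" "\<lambda>(ks, j). int j # ks"])
       (auto simp: length_Suc_conv prod.lessThan_Suc_shift Y_def y_def mult_ac simp del: prod.lessThan_Suc)
  also have "\<dots> \<longleftrightarrow> ((\<lambda>ks. correlator q1 q2 c ks * (\<Prod>j<Suc n. z j powi (- (ks ! j)))) has_sum (c * (V * W)))
      {ks. length ks = Suc n}"
    by (rule has_sum_cong_neutral) (auto simp: length_Suc_conv correlator_Cons[OF q2])
  also have "c * (V * W) = c ^ Suc n * (\<Prod>j<Suc n. \<Prod>i<j. \<phi> (z j / z i))"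
    unfolding prod.lessThan_Suc_shift by (simp add: V_def W_def y_def prod.distrib mult_ac)
  finally show ?case unfolding \<phi>_def .
qed

section \<open>Polynomials and rational functions in the variables\<close>

lemma mpoly_eval_eq: "mpoly_eval z = monoid_alg_ext (\<lambda>k. k)
    (\<lambda>m. \<Prod>j\<in>Poly_Mapping.keys m. z j ^ Poly_Mapping.lookup m j)"
  by (rule ext) (simp add: mpoly_eval_def monoid_alg_ext_def)

lemma monomial_eval_superset:
  fixes z :: "nat \<Rightarrow> complex"
  assumes "finite A" "Poly_Mapping.keys m \<subseteq> A"
  shows "(\<Prod>j\<in>Poly_Mapping.keys m. z j ^ Poly_Mapping.lookup m j) = (\<Prod>j\<in>A. z j ^ Poly_Mapping.lookup m j)"
  by (rule prod.mono_neutral_left) (use assms in \<open>auto simp: in_keys_iff\<close>)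

lemma monomial_eval_add:
  fixes z :: "nat \<Rightarrow> complex"
  shows "(\<Prod>j\<in>Poly_Mapping.keys (m + m'). z j ^ Poly_Mapping.lookup (m + m') j) =
    (\<Prod>j\<in>Poly_Mapping.keys m. z j ^ Poly_Mapping.lookup m j) *
    (\<Prod>j\<in>Poly_Mapping.keys m'. z j ^ Poly_Mapping.lookup m' j)"
proof -
  let ?A = "Poly_Mapping.keys m \<union> Poly_Mapping.keys m'"
  show ?thesis
    using monomial_eval_superset[of ?A m z] monomial_eval_superset[of ?A m' z]
      monomial_eval_superset[of ?A "m + m'" z] keys_add[of m m']
    by (simp add: lookup_add power_add prod.distrib)
qed

lemma mpoly_eval_add: "mpoly_eval z (p + q) = mpoly_eval z p + mpoly_eval z q"
  unfolding mpoly_eval_eq by (rule monoid_alg_ext_add) simp_all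

lemma mpoly_eval_mult: "mpoly_eval z (p * q) = mpoly_eval z p * mpoly_eval z q"
  unfolding mpoly_eval_eq by (rule monoid_alg_ext_mult) (simp_all add: monomial_eval_add)

lemma mpoly_eval_diff: "mpoly_eval z (p - q) = mpoly_eval z p - mpoly_eval z q"
  using mpoly_eval_add[of z "p - q" q] by simp

lemma mpoly_eval_cst: "mpoly_eval z (cst k) = k"
  by (simp add: mpoly_eval_eq cst_def monoid_alg_ext_single)

definition mvar :: "nat \<Rightarrow> mpoly" where
  "mvar j = Poly_Mapping.single (Poly_Mapping.single j 1) 1"

lemma mpoly_eval_mvar: "mpoly_eval z (mvar j) = z j"
  by (simp add: mpoly_eval_eq mvar_def monoid_alg_ext_single)

lemma mpoly_eval_prod: "mpoly_eval z (\<Prod>i\<in>I. p i) = (\<Prod>i\<in>I. mpoly_eval z (p i))"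
proof -
  have "mpoly_eval z 1 = 1" using mpoly_eval_cst[of z 1] by (simp add: cst_def)
  thus ?thesis by (induction I rule: infinite_finite_induct) (simp_all add: mpoly_eval_mult)
qed

lemmas mpoly_eval_simps =
  mpoly_eval_add mpoly_eval_mult mpoly_eval_diff mpoly_eval_cst mpoly_eval_mvar mpoly_eval_prod

lemma digits_unique:
  fixes a b :: "nat \<Rightarrow> nat"
  assumes "\<And>j. j < M \<Longrightarrow> a j < N" "\<And>j. j < M \<Longrightarrow> b j < N"
    and "(\<Sum>j<M. a j * N ^ j) = (\<Sum>j<M. b j * N ^ j)" "j < M"
  shows "a j = b j"
  using assms
proof (induction M arbitrary: a b j)
  case (Suc M)
  have split: "(\<Sum>j<Suc M. f j * N ^ j) = f 0 + N * (\<Sum>j<M. f (Suc j) * N ^ j)" for f :: "nat \<Rightarrow> nat"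
    by (subst sum.lessThan_Suc_shift) (simp add: sum_distrib_left mult_ac)
  have eq: "a 0 + N * (\<Sum>j<M. a (Suc j) * N ^ j) = b 0 + N * (\<Sum>j<M. b (Suc j) * N ^ j)"
    using Suc.prems(3) unfolding split .
  have less: "a 0 < N" "b 0 < N" using Suc.prems(1,2) by auto
  have "a 0 = b 0" using arg_cong[OF eq, of "\<lambda>x. x mod N"] less by simp
  moreover have "(\<Sum>j<M. a (Suc j) * N ^ j) = (\<Sum>j<M. b (Suc j) * N ^ j)"
    using arg_cong[OF eq, of "\<lambda>x. x div N"] less by simp
  hence "a (Suc i) = b (Suc i)" if "i < M" for i
    using Suc.IH[of "\<lambda>j. a (Suc j)" "\<lambda>j. b (Suc j)" i] Suc.prems(1,2) that by auto
  ultimately show ?case using Suc.prems(4) by (cases j) auto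
qed simp

text \<open>Kronecker substitution: put \<open>z\<^sub>j = t ^ (N ^ j)\<close> with \<open>N\<close> larger than all exponents that occur.  Distinct
  monomials become distinct powers of \<open>t\<close>, by uniqueness of base-\<open>N\<close> expansions, and for all small
  \<open>t > 0\<close> the point lies in the region.  A univariate polynomial with infinitely many roots is zero.\<close>

lemma mpoly_zero_if_zero_on_region:
  assumes "R > 0" "\<And>z. z \<in> region R n \<Longrightarrow> mpoly_eval z p = 0"
  shows "p = 0"
proof (rule ccontr)
  assume "p \<noteq> 0"
  define K where "K = Poly_Mapping.keys p"
  have "finite K" by (simp add: K_def)
  define N where "N = 2 + (\<Sum>m\<in>K. \<Sum>j\<in>Poly_Mapping.keys m. Poly_Mapping.lookup m j)"
  define M where "M = Suc (Max (insert 0 (\<Union>m\<in>K. Poly_Mapping.keys m)))"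
  define wt where "wt = (\<lambda>m. \<Sum>j<M. Poly_Mapping.lookup m j * N ^ j)"
  have keys_M: "Poly_Mapping.keys m \<subseteq> {..<M}" if "m \<in> K" for m
    using that \<open>finite K\<close> by (auto simp: M_def less_Suc_eq_le intro!: Max_ge)
  have lookup_N: "Poly_Mapping.lookup m j < N" if "m \<in> K" for m j
  proof (cases "j \<in> Poly_Mapping.keys m")
    case True
    have "Poly_Mapping.lookup m j \<le> (\<Sum>j\<in>Poly_Mapping.keys m. Poly_Mapping.lookup m j)"
      by (rule member_le_sum) (use True in auto)
    also have "\<dots> \<le> (\<Sum>m\<in>K. \<Sum>j\<in>Poly_Mapping.keys m. Poly_Mapping.lookup m j)"
      by (rule member_le_sum[of _ _ "\<lambda>m. \<Sum>j\<in>Poly_Mapping.keys m. Poly_Mapping.lookup m j"])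
         (use that \<open>finite K\<close> in auto)
    finally show ?thesis by (simp add: N_def)
  qed (simp add: in_keys_iff N_def)
  have inj: "inj_on wt K"
  proof (rule inj_onI, rule poly_mapping_eqI)
    fix m m' j assume m: "m \<in> K" "m' \<in> K" "wt m = wt m'"
    show "Poly_Mapping.lookup m j = Poly_Mapping.lookup m' j"
    proof (cases "j < M")
      case True
      show ?thesis
        by (rule digits_unique[OF _ _ _ True, of _ N]) (use m lookup_N in \<open>auto simp: wt_def\<close>)
    next
      case False
      hence "j \<notin> Poly_Mapping.keys m" "j \<notin> Poly_Mapping.keys m'" using keys_M m by blast+
      thus ?thesis by (simp add: in_keys_iff)
    qed
  qed
  define f where "f = (\<Sum>m\<in>K. Polynomial.monom (Poly_Mapping.lookup p m) (wt m))"
  have f: "poly f t = mpoly_eval (\<lambda>j. t ^ (N ^ j)) p" for t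
    unfolding f_def mpoly_eval_def poly_sum K_def[symmetric]
  proof (rule sum.cong[OF refl])
    fix m assume "m \<in> K"
    thus "poly (Polynomial.monom (Poly_Mapping.lookup p m) (wt m)) t = Poly_Mapping.lookup p m *
      (\<Prod>j\<in>Poly_Mapping.keys m. (t ^ N ^ j) ^ Poly_Mapping.lookup m j)"
      using monomial_eval_superset[OF _ keys_M, of m "\<lambda>j. t ^ (N ^ j)"]
      by (simp add: poly_monom wt_def power_sum mult.commute flip: power_mult)
  qed
  have "poly f (of_real t) = 0" if t: "0 < t" "t < 1 / (R + 1)" for t
  proof -
    have t1: "t < 1" "R * t < 1" using t \<open>R > 0\<close> by (simp_all add: field_simps)
       (use t \<open>R > 0\<close> in \<open>smt (verit) mult_pos_pos\<close>)
    have "R * t ^ (N ^ Suc i) < t ^ (N ^ i)" for i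
    proof -
      have "N ^ Suc i \<ge> N ^ i + 1"
      proof -
        have "N ^ i \<ge> 1" "N \<ge> 2" by (simp_all add: N_def)
        hence "2 * N ^ i \<le> N * N ^ i" by simp
        thus ?thesis using \<open>N ^ i \<ge> 1\<close> unfolding power_Suc by linarith
      qed
      hence "t ^ (N ^ Suc i) \<le> t ^ (N ^ i + 1)" using t t1 by (intro power_decreasing) auto
      hence "R * t ^ (N ^ Suc i) \<le> (R * t) * t ^ (N ^ i)" using \<open>R > 0\<close> by simp
      also have "\<dots> < 1 * t ^ (N ^ i)" using t t1 by (intro mult_strict_right_mono) auto
      finally show ?thesis by simp
    qed
    hence "(\<lambda>j. of_real t ^ (N ^ j)) \<in> region R n"
      using t by (auto simp: region_def norm_power simp del: power_Suc)
    thus ?thesis unfolding f by (rule assms(2))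
  qed
  hence "of_real ` {0<..<1 / (R + 1)} \<subseteq> {x. poly f x = 0}" by auto
  moreover have "infinite (of_real ` {0<..<1 / (R + 1)} :: complex set)"
    using \<open>R > 0\<close> by (subst finite_image_iff) (auto simp: inj_on_def)
  ultimately have "f = 0" using poly_roots_finite finite_subset by blast
  moreover obtain m where m: "m \<in> K" using \<open>p \<noteq> 0\<close>
    by (metis K_def in_keys_iff lookup_zero poly_mapping_eqI)
  moreover have "coeff f (wt m) = Poly_Mapping.lookup p m"
  proof -
    have "coeff f (wt m) = (\<Sum>m'\<in>K. if m' = m then Poly_Mapping.lookup p m' else 0)"
      unfolding f_def coeff_sum by (intro sum.cong refl) (use m inj in \<open>auto simp: inj_on_def\<close>)
    thus ?thesis using m \<open>finite K\<close> by simp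
  qed
  ultimately show False by (simp add: K_def in_keys_iff)
qed

text \<open>Where both expansions converge they have the same sum, so the cross products of numerators and
  denominators agree on a region.\<close>

lemma has_expansion_unique:
  assumes "has_expansion n f r" "has_expansion n f r'"
  shows "r = r'"
proof -
  obtain P Q R where 1: "Q \<noteq> 0" "r = Fract P Q" "R > 0" "\<And>z. z \<in> region R n \<Longrightarrow> \<exists>S.
      ((\<lambda>ks. f ks * (\<Prod>j<n. z j powi (- (ks ! j)))) has_sum S) {ks. length ks = n} \<and>
      mpoly_eval z Q * S = mpoly_eval z P"
    using assms(1) unfolding has_expansion_def by blast
  obtain P' Q' R' where 2: "Q' \<noteq> 0" "r' = Fract P' Q'" "R' > 0" "\<And>z. z \<in> region R' n \<Longrightarrow> \<exists>S.
      ((\<lambda>ks. f ks * (\<Prod>j<n. z j powi (- (ks ! j)))) has_sum S) {ks. length ks = n} \<and>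
      mpoly_eval z Q' * S = mpoly_eval z P'"
    using assms(2) unfolding has_expansion_def by blast
  have mono: "z \<in> region a n" if "z \<in> region (max R R') n" "a \<le> max R R'" for z a
  proof -
    have "norm (z i) > a * norm (z (Suc i))" if "Suc i < n" for i
    proof -
      have "a * norm (z (Suc i)) \<le> max R R' * norm (z (Suc i))"
        by (rule mult_right_mono) (use \<open>a \<le> _\<close> in auto)
      also have "\<dots> < norm (z i)" using \<open>z \<in> _\<close> \<open>Suc i < n\<close> by (simp add: region_def)
      finally show ?thesis .
    qed
    thus ?thesis using that(1) by (simp add: region_def)
  qed
  have "P * Q' - P' * Q = 0"
  proof (rule mpoly_zero_if_zero_on_region)
    show "max R R' > 0" using 1 by simp
    fix z assume z: "z \<in> region (max R R') n"
    obtain S where S: "((\<lambda>ks. f ks * (\<Prod>j<n. z j powi (- (ks ! j)))) has_sum S) {ks. length ks = n}"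
      "mpoly_eval z Q * S = mpoly_eval z P"
      using 1(4)[OF mono[OF z]] by auto
    obtain S' where S': "((\<lambda>ks. f ks * (\<Prod>j<n. z j powi (- (ks ! j)))) has_sum S') {ks. length ks = n}"
      "mpoly_eval z Q' * S' = mpoly_eval z P'"
      using 2(4)[OF mono[OF z]] by auto
    have "S = S'" using S(1) S'(1) by (rule has_sum_unique)
    thus "mpoly_eval z (P * Q' - P' * Q) = 0"
      using S(2) S'(2) by (simp add: mpoly_eval_simps flip: S(2) S'(2))
  qed
  thus ?thesis using 1 2 by (simp add: eq_fract)
qed

lemma region_norm_less:
  assumes "z \<in> region R n" "R \<ge> 1" "i < j" "j < n"
  shows "R * norm (z j) < norm (z i)"
  using assms(3,4)
proof (induction j)
  case (Suc j)
  have step: "R * norm (z (Suc j)) < norm (z j)" using assms(1) Suc.prems by (simp add: region_def)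
  show ?case
  proof (cases "i = j")
    case False
    hence "R * norm (z j) < norm (z i)" using Suc by simp
    moreover have "norm (z j) \<le> R * norm (z j)"
      using mult_right_mono[OF assms(2), of "norm (z j)"] by simp
    ultimately show ?thesis using step by simp
  qed (use step in simp)
qed simp

definition of_mpoly :: "mpoly \<Rightarrow> ratfun" where
  "of_mpoly p = Fract p 1"

lemma of_mpoly_simps:
  "of_mpoly 0 = 0" "of_mpoly 1 = 1" "of_mpoly (p - q) = of_mpoly p - of_mpoly q"
  "of_mpoly (p * q) = of_mpoly p * of_mpoly q"
  by (simp_all add: of_mpoly_def Zero_fract_def One_fract_def)

lemma of_mpoly_prod: "of_mpoly (\<Prod>i\<in>I. p i) = (\<Prod>i\<in>I. of_mpoly (p i))"
  by (induction I rule: infinite_finite_induct) (simp_all add: of_mpoly_simps)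

lemma of_mpoly_eq_0_iff: "of_mpoly p = 0 \<longleftrightarrow> p = 0"
  by (simp add: of_mpoly_def Zero_fract_def eq_fract)

lemma Fract_eq_divide: "Fract p q = of_mpoly p / of_mpoly q"
  by (simp add: of_mpoly_def)

lemma Var_eq: "Var j = of_mpoly (mvar j)"
  by (simp add: Var_def of_mpoly_def mvar_def)

lemma Cst_eq: "Cst k = of_mpoly (cst k)"
  by (simp add: Cst_def of_mpoly_def)

lemma Cst_mult: "Cst (a * b) = Cst a * Cst b"
  by (simp add: Cst_eq cst_def mult_single flip: of_mpoly_simps)

lemma Cst_1: "Cst 1 = 1"
  by (simp add: Cst_eq cst_def of_mpoly_simps)

lemma Cst_power: "Cst (a ^ m) = Cst a ^ m"
  by (induction m) (simp_all add: Cst_mult Cst_1)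

lemma mvar_diff_nonzero: "i \<noteq> j \<Longrightarrow> mvar i - cst k * mvar j \<noteq> 0"
proof
  assume "i \<noteq> j" "mvar i - cst k * mvar j = 0"
  from this(2)[THEN arg_cong[where f = "mpoly_eval (\<lambda>l. if l = i then 1 else 0)"]] \<open>i \<noteq> j\<close>
  have "(1::complex) = mpoly_eval (\<lambda>l. if l = i then 1 else 0) 0" by (simp add: mpoly_eval_simps)
  thus False by (simp add: mpoly_eval_def)
qed

lemma Var_diff_nonzero: "i \<noteq> j \<Longrightarrow> Var i - Cst k * Var j \<noteq> 0"
proof -
  assume "i \<noteq> j"
  have "Var i - Cst k * Var j = of_mpoly (mvar i - cst k * mvar j)"
    by (simp add: Var_eq Cst_eq of_mpoly_simps)
  thus ?thesis using mvar_diff_nonzero[OF \<open>i \<noteq> j\<close>] by (simp add: of_mpoly_eq_0_iff)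
qed

section \<open>The correlation function\<close>

text \<open>The ratio \<open>1 + |q1| + |q2|\<close> of the region makes all \<open>|q1 z\<^sub>j/z\<^sub>i|\<close> and \<open>|q2 z\<^sub>j/z\<^sub>i|\<close> less than
  \<open>1\<close>, and with it every geometric series in the contractions convergent.\<close>

lemma matrix_coeff_vacuum:
  assumes "q2 \<noteq> 0" "\<And>m. m > 0 \<Longrightarrow> q2 ^ m \<noteq> 1"
  shows "matrix_coeff n (rho_e q1 q2 c) (vac_dual q1 q2) (vac q1 q2) =
    Cst (c ^ n) * (\<Prod>j<n. \<Prod>i<j. (Var i - Var j) * (Var i - Cst (q1 * q2) * Var j) /
       ((Var i - Cst q1 * Var j) * (Var i - Cst q2 * Var j)))" (is "_ = ?r")
proof -
  define P where "P = cst (c ^ n) * (\<Prod>j<n. \<Prod>i<j. (mvar i - mvar j) * (mvar i - cst (q1 * q2) * mvar j))"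
  define Q where "Q = (\<Prod>j<n. \<Prod>i<j. (mvar i - cst q1 * mvar j) * (mvar i - cst q2 * mvar j))"
  have "?r = Fract P Q"
    unfolding P_def Q_def Fract_eq_divide
    by (simp add: of_mpoly_prod of_mpoly_simps Var_eq Cst_eq prod_dividef)
  moreover have "has_expansion n
      (\<lambda>ks. vac_dual q1 q2 (foldr (rho_e q1 q2 c) ks (vac q1 q2))) (Fract P Q)"
    unfolding has_expansion_def
  proof (intro exI conjI ballI)
    have "mvar i \<noteq> cst k * mvar j" if "i < j" for i j k
      using mvar_diff_nonzero[of i j k] that by auto
    thus "Q \<noteq> 0" by (auto simp: Q_def)
    show "Fract P Q = Fract P Q" ..
    let ?R = "1 + norm q1 + norm q2"
    show "?R > 0" by (smt (verit) norm_ge_zero)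
    fix z assume z: "z \<in> region ?R n"
    let ?\<phi> = "\<lambda>t. (1 - t) * (1 - q1 * q2 * t) / ((1 - q1 * t) * (1 - q2 * t))"
    let ?S = "c ^ n * (\<Prod>j<n. \<Prod>i<j. ?\<phi> (z j / z i))"
    have z0: "z i \<noteq> 0" if "i < n" for i using z that by (simp add: region_def)
    have bound: "norm (q1 * (z j / z i)) < 1 \<and> norm (q2 * (z j / z i)) < 1" if ij: "i < j" "j < n" for i j
    proof -
      have "?R * norm (z j) < norm (z i)" by (rule region_norm_less[OF z _ ij]) simp
      hence "norm q1 * norm (z j) < norm (z i)" "norm q2 * norm (z j) < norm (z i)"
        by (smt (verit) distrib_right mult_nonneg_nonneg norm_ge_zero mult_1)+
      thus ?thesis using z0[of i] ij by (simp add: norm_mult norm_divide divide_simps)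
    qed
    show "((\<lambda>ks. vac_dual q1 q2 (foldr (rho_e q1 q2 c) ks (vac q1 q2)) *
       (\<Prod>j<n. z j powi (- (ks ! j)))) has_sum ?S) {ks. length ks = n}"
      using has_sum_correlator[OF assms z0 bound, where c = c]
      by (simp add: vac_dual_rho_e correlator_def)
    have "(z i - q1 * z j) * (z i - q2 * z j) * ?\<phi> (z j / z i) =
        (z i - z j) * (z i - q1 * q2 * z j)" if ij: "i < j" "j < n" for i j
    proof -
      define t where "t = z j / z i"
      have zj: "z j = t * z i" using z0[of i] ij by (simp add: t_def)
      have nz: "1 - q1 * t \<noteq> 0" "1 - q2 * t \<noteq> 0" using bound[OF ij] by (auto simp flip: t_def)
      have "(z i - q1 * (t * z i)) * (z i - q2 * (t * z i)) * ?\<phi> t =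
          z i * z i * ((1 - q1 * t) * (1 - q2 * t) * ?\<phi> t)"
      proof -
        have "z i - q * (t * z i) = z i * (1 - q * t)" for q by (simp add: algebra_simps)
        thus ?thesis by (simp only: mult_ac)
      qed
      also have "(1 - q1 * t) * (1 - q2 * t) * ?\<phi> t = (1 - t) * (1 - q1 * q2 * t)"
        using nz by simp
      finally show ?thesis unfolding t_def[symmetric] unfolding zj by (simp add: algebra_simps)
    qed
    hence "(\<Prod>j<n. \<Prod>i<j. (z i - q1 * z j) * (z i - q2 * z j) * ?\<phi> (z j / z i)) =
        (\<Prod>j<n. \<Prod>i<j. (z i - z j) * (z i - q1 * q2 * z j))"
      by (intro prod.cong refl) auto
    thus "mpoly_eval z Q * ?S = mpoly_eval z P"
      unfolding P_def Q_def mpoly_eval_simps by (simp only: prod.distrib mult_ac)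
  qed
  ultimately show ?thesis
    unfolding matrix_coeff_def using has_expansion_unique by (metis the_equality)
qed

lemma prod_pairs_cmult:
  fixes k :: "'a::comm_monoid_mult"
  shows "(\<Prod>j<n. \<Prod>i<j. k * F i j) = k ^ (n * (n - 1) div 2) * (\<Prod>j<n. \<Prod>i<j. F i j)"
proof -
  have "(\<Sum>j<n. j) = n * (n - 1) div 2" using Sum_Ico_nat[of 0 n] by (simp add: atLeast0LessThan)
  thus ?thesis by (simp add: prod.distrib flip: power_sum)
qed

text \<open>The matrix coefficient and the product of the \<open>\<omega>\<close> are combined pair by pair.\<close>

theorem proposition8p3:
  fixes q1 q2 q3 c :: complex and n :: nat
  assumes "q1 \<noteq> 0" "q2 \<noteq> 0" "q3 \<noteq> 0" "c \<noteq> 0"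
    and "q1 * q2 * q3 = 1"
    and "\<And>m::nat. m > 0 \<Longrightarrow> q1 ^ m \<noteq> 1 \<and> q2 ^ m \<noteq> 1 \<and> q3 ^ m \<noteq> 1"
  shows "corr_fun q1 q2 q3 n (rho_e q1 q2 c) (vac_dual q1 q2) (vac q1 q2) =
    Cst ((- q3) powi (- int (n * (n - 1) div 2)) * c ^ n) *
    (\<Prod>j<n. \<Prod>i<j. (Var i - Cst q3 * Var j) * (Var j - Cst q3 * Var i) / (Var i - Var j) ^ 2)"
proof -
  let ?F = "\<lambda>i j. (Var i - Cst q3 * Var j) * (Var j - Cst q3 * Var i) / (Var i - Var j) ^ 2"
  have "(Var i - Var j) * (Var i - Cst (q1 * q2) * Var j) /
       ((Var i - Cst q1 * Var j) * (Var i - Cst q2 * Var j)) * omega_m q1 q2 q3 (Var i) (Var j)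
     = Cst (inverse (- q3)) * ?F i j" if "i < j" for i j
  proof -
    have nz: "Var i - Cst k * Var j \<noteq> 0" for k
      by (rule Var_diff_nonzero) (use that in simp)
    have nz1: "Var i - Var j \<noteq> 0" using nz[of 1] by (simp add: Cst_1)
    have q12: "q1 * q2 = inverse q3"
      using assms(5) by (metis inverse_unique mult.commute)
    have inv: "Cst (inverse (- q3)) = - Cst (inverse q3)"
      by (simp add: Cst_eq cst_def of_mpoly_def single_uminus)
    have one: "Cst (inverse q3) * Cst q3 = 1" using assms(3) by (simp flip: Cst_mult add: Cst_1)
    have "Cst (inverse (- q3)) * (Var j - Cst q3 * Var i) =
        Cst (inverse q3) * Cst q3 * Var i - Cst (inverse q3) * Var j"
      unfolding inv by (simp add: algebra_simps)
    hence "Var i - Cst (inverse q3) * Var j = Cst (inverse (- q3)) * (Var j - Cst q3 * Var i)"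
      unfolding one by simp
    thus ?thesis using nz[of q1] nz[of q2] nz1 unfolding omega_m_def q12
      by (simp add: divide_simps power2_eq_square power3_eq_cube)
  qed
  hence "(\<Prod>j<n. \<Prod>i<j. (Var i - Var j) * (Var i - Cst (q1 * q2) * Var j) /
       ((Var i - Cst q1 * Var j) * (Var i - Cst q2 * Var j)) * omega_m q1 q2 q3 (Var i) (Var j))
     = (\<Prod>j<n. \<Prod>i<j. Cst (inverse (- q3)) * ?F i j)"
    by (intro prod.cong refl) auto
  also have "\<dots> = Cst (inverse (- q3)) ^ (n * (n - 1) div 2) * (\<Prod>j<n. \<Prod>i<j. ?F i j)"
    by (rule prod_pairs_cmult)
  finally have pairs: "(\<Prod>j<n. \<Prod>i<j. (Var i - Var j) * (Var i - Cst (q1 * q2) * Var j) /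
       ((Var i - Cst q1 * Var j) * (Var i - Cst q2 * Var j)) * omega_m q1 q2 q3 (Var i) (Var j))
     = Cst (inverse (- q3)) ^ (n * (n - 1) div 2) * (\<Prod>j<n. \<Prod>i<j. ?F i j)" .
  have q3: "Cst ((- q3) powi (- int (n * (n - 1) div 2))) = Cst (inverse (- q3)) ^ (n * (n - 1) div 2)"
    unfolding power_int_minus power_int_of_nat Cst_power[symmetric] power_inverse ..
  have mc: "matrix_coeff n (rho_e q1 q2 c) (vac_dual q1 q2) (vac q1 q2) =
    Cst (c ^ n) * (\<Prod>j<n. \<Prod>i<j. (Var i - Var j) * (Var i - Cst (q1 * q2) * Var j) /
       ((Var i - Cst q1 * Var j) * (Var i - Cst q2 * Var j)))"
    by (rule matrix_coeff_vacuum) (use assms(2,6) in auto)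
  have "corr_fun q1 q2 q3 n (rho_e q1 q2 c) (vac_dual q1 q2) (vac q1 q2) =
      Cst (c ^ n) * (\<Prod>j<n. \<Prod>i<j. (Var i - Var j) * (Var i - Cst (q1 * q2) * Var j) /
       ((Var i - Cst q1 * Var j) * (Var i - Cst q2 * Var j)) * omega_m q1 q2 q3 (Var i) (Var j))"
    unfolding corr_fun_def mc
    by (simp only: prod.distrib mult.assoc)
  also have "\<dots> = Cst ((- q3) powi (- int (n * (n - 1) div 2)) * c ^ n) * (\<Prod>j<n. \<Prod>i<j. ?F i j)"
    unfolding pairs unfolding Cst_mult q3 by (simp only: mult_ac)
  finally show ?thesis .
qed

end
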